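(* Let $k$ be a field and let $Q$ be a row-finite quiver. Assume that for each vertex $i$ in $Q$, there exists either a path which starts at $i$ and terminates at a sink, or a non-cyclic left-infinite path which starts at $i$. Then the representation $\mathcal{F}\oplus\mathcal{N}$ of $L_k(Q)$ is faithful.
   Context: A quiver $Q=(Q_0,Q_1;s,t)$ consists of a set $Q_0$ of vertices, a set $Q_1$ of arrows and maps $s,t\colon Q_1\to Q_0$ (starting and terminating vertex). A vertex is a sink if no arrow starts at it, an infinite emitter if infinitely many arrows start at it, and regular if it is neither. $Q$ is row-finite if it has no infinite emitter. A finite path of length $n\ge1$ is a sequence $p=\alpha_n\cdots\alpha_2\alpha_1$ of arrows with $t(\alpha_i)=s(\alpha_{i+1})$; $s(p)=s(\alpha_1)$, $t(p)=t(\alpha_n)$; for each vertex $i$ there is a trivial path $e_i$ of length $0$ with $s(e_i)=t(e_i)=i$. Concatenation is written from right to left. An oriented cycle is a nontrivial path $p$ with $s(p)=t(p)$. Leavitt path algebra: $L_k(Q)$ is the $k$-algebra (algebras are not required to be unital) given by generators $\{e_i,\alpha,\alpha^*\mid i\in Q_0,\alpha\in Q_1\}$ subject to: (0) $e_ie_j=\delta_{ij}e_i$ for $i,j\in Q_0$; (1) $e_{t(\alpha)}\alpha=\alpha=\alpha e_{s(\alpha)}$; (2) $e_{s(\alpha)}\alpha^*=\alpha^*=\alpha^*e_{t(\alpha)}$; (3) $\alpha\beta^*=\delta_{\alpha,\beta}e_{t(\alpha)}$ for $\alpha,\beta\in Q_1$; (4) $\sum_{\{\alpha\in Q_1\mid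 s(\alpha)=i\}}\alpha^*\alpha=e_i$ for every regular vertex $i$. A representation is a $k$-vector space $M$ with an algebra homomorphism $L_k(Q)\to{\rm End}_k(M)$; it is faithful if this homomorphism is injective. A left-infinite path is an infinite sequence $p=\cdots\alpha_n\cdots\alpha_2\alpha_1$ of arrows with $t(\alpha_i)=s(\alpha_{i+1})$ for all $i\ge1$; it starts at $s(p)=s(\alpha_1)$; $Q_\infty$ is the set of them. For $n\ge0$, $\tau_{>n}(p)=\cdots\alpha_{n+2}\alpha_{n+1}$. A left-infinite path is cyclic if it is of the form $q^\infty=\cdots qq\cdots q$ for an oriented cycle $q$ (equivalently $p=\tau_{>n}(p)$ for some $n\ge1$), and non-cyclic otherwise. $\mathcal{F}$ is the $k$-vector space with basis $Q_\infty$, with $L_k(Q)$-action, for $p=\cdots\alpha_2\alpha_1$: $e_i.p=\delta_{i,s(p)}p$; $\alpha.p=\delta_{\alpha,\alpha_1}\tau_{>1}(p)$; $\alpha^*.p=p\alpha$ if $t(\alpha)=s(p)$ and $0$ otherwise. $\mathcal{N}$ is the $k$-vector space with basis the finite paths terminating at a sink (trivial paths at sinks included), with action: $e_i.p=\delta_{i,s(p)}p$; $\alpha.p=0$ if $p$ has length $0$, and $\alpha.p=\delta_{\alpha,\alpha_1}\,\alpha_n\cdots\alpha_2$ for $p=\alpha_n\cdots\alpha_2\alpha_1$ (read as $e_{t(\alpha_1)}$ when $n=1$); $\alpha^*.p=p\alpha$ if $t(\alpha)=s(p)$ and $0$ otherwise. *)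

theory Defs
  imports
    "HOL-Library.Poly_Mapping"
    "HOL-Library.FuncSet"
    "HOL-Library.Product_Plus"
    "Graph_Theory.Arc_Walk"
begin

section \<open>Quivers and paths\<close>

text \<open>
  A quiver is a \<^locale>\<open>wf_digraph\<close>: loops, parallel arrows and infinitely many vertices or arrows
  are allowed; \<^const>\<open>tail\<close> and \<^const>\<open>head\<close> are the starting and the terminating vertex of an arrow.
  A finite path is a pair \<open>(u, w)\<close> with \<open>w\<close> an \<open>awalk\<close> starting at \<open>u\<close>. Paths are listed in the order
  of traversal, so the path written \<open>\<alpha>\<^sub>n \<dots> \<alpha>\<^sub>2 \<alpha>\<^sub>1\<close> from right to left is the list
  \<open>[\<alpha>\<^sub>1, \<alpha>\<^sub>2, \<dots>, \<alpha>\<^sub>n]\<close>, and the trivial path at \<open>i\<close> is \<open>(i, [])\<close>.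
\<close>

definition sink :: "('v, 'a) pre_digraph \<Rightarrow> 'v \<Rightarrow> bool" where
  "sink Q i \<longleftrightarrow> i \<in> verts Q \<and> out_arcs Q i = {}"

definition infinite_emitter :: "('v, 'a) pre_digraph \<Rightarrow> 'v \<Rightarrow> bool" where
  "infinite_emitter Q i \<longleftrightarrow> i \<in> verts Q \<and> infinite (out_arcs Q i)"

definition regular_vertex :: "('v, 'a) pre_digraph \<Rightarrow> 'v \<Rightarrow> bool" where
  "regular_vertex Q i \<longleftrightarrow> i \<in> verts Q \<and> \<not> sink Q i \<and> \<not> infinite_emitter Q i"

definition row_finite :: "('v, 'a) pre_digraph \<Rightarrow> bool" where
  "row_finite Q \<longleftrightarrow> \<not> (\<exists>i. infinite_emitter Q i)"

definition sink_paths :: "('v, 'a) pre_digraph \<Rightarrow> ('v \<times> 'a list) set" where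
  "sink_paths Q = {(u, w). \<exists>v. pre_digraph.awalk Q u w v \<and> sink Q v}"

text \<open>The left-infinite path \<open>\<dots> \<alpha>\<^sub>3 \<alpha>\<^sub>2 \<alpha>\<^sub>1\<close> is the sequence \<open>p\<close> with \<open>p 0 = \<alpha>\<^sub>1\<close>, \<open>p 1 = \<alpha>\<^sub>2\<close>, \<open>\<dots>\<close>\<close>

definition left_infinite_paths :: "('v, 'a) pre_digraph \<Rightarrow> (nat \<Rightarrow> 'a) set" where
  "left_infinite_paths Q = {p. \<forall>n. p n \<in> arcs Q \<and> head Q (p n) = tail Q (p (Suc n))}"

definition start_inf :: "('v, 'a) pre_digraph \<Rightarrow> (nat \<Rightarrow> 'a) \<Rightarrow> 'v" where
  "start_inf Q p = tail Q (p 0)"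

definition truncate_inf :: "nat \<Rightarrow> (nat \<Rightarrow> 'a) \<Rightarrow> nat \<Rightarrow> 'a" where
  "truncate_inf n p = (\<lambda>i. p (n + i))"

definition cycle_power :: "'a list \<Rightarrow> nat \<Rightarrow> 'a" where
  "cycle_power q = (\<lambda>n. q ! (n mod length q))"

text \<open>Oriented cycles may repeat vertices, unlike the library's \<open>cycle\<close>.\<close>

definition oriented_cycle :: "('v, 'a) pre_digraph \<Rightarrow> 'a list \<Rightarrow> bool" where
  "oriented_cycle Q q \<longleftrightarrow> q \<noteq> [] \<and> (\<exists>u. pre_digraph.awalk Q u q u)"

definition cyclic_inf :: "('v, 'a) pre_digraph \<Rightarrow> (nat \<Rightarrow> 'a) \<Rightarrow> bool" where
  "cyclic_inf Q p \<longleftrightarrow> (\<exists>q. oriented_cycle Q q \<and> p = cycle_power q)"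


section \<open>Vector spaces with a given basis\<close>

definition pm_scale :: "'k::field \<Rightarrow> ('b \<Rightarrow>\<^sub>0 'k) \<Rightarrow> ('b \<Rightarrow>\<^sub>0 'k)" where
  "pm_scale c f = Poly_Mapping.map ((*) c) f"

definition space_on :: "'b set \<Rightarrow> ('b \<Rightarrow>\<^sub>0 'k::field) set" where
  "space_on B = {f. Poly_Mapping.keys f \<subseteq> B}"

definition basis_vec :: "'b \<Rightarrow> ('b \<Rightarrow>\<^sub>0 'k::field)" where
  "basis_vec b = Poly_Mapping.single b 1"

definition linear_ext ::
    "('k::field \<Rightarrow> 'm::ab_group_add \<Rightarrow> 'm) \<Rightarrow> ('b \<Rightarrow> 'm) \<Rightarrow> ('b \<Rightarrow>\<^sub>0 'k) \<Rightarrow> 'm" where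
  "linear_ext scl g f = (\<Sum>b\<in>Poly_Mapping.keys f. scl (Poly_Mapping.lookup f b) (g b))"


section \<open>Algebras without unit and their representations\<close>

record ('k, 'a) nonunital_algebra =
  alg_carrier :: "'a set"
  alg_add :: "'a \<Rightarrow> 'a \<Rightarrow> 'a"
  alg_mult :: "'a \<Rightarrow> 'a \<Rightarrow> 'a"
  alg_scale :: "'k \<Rightarrow> 'a \<Rightarrow> 'a"

definition algebra_hom ::
    "('k, 'a) nonunital_algebra \<Rightarrow> ('k, 'b) nonunital_algebra \<Rightarrow> ('a \<Rightarrow> 'b) \<Rightarrow> bool" where
  "algebra_hom A B h \<longleftrightarrow>
     h \<in> alg_carrier A \<rightarrow> alg_carrier B \<and>
     (\<forall>x\<in>alg_carrier A. \<forall>y\<in>alg_carrier A.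
        h (alg_add A x y) = alg_add B (h x) (h y) \<and>
        h (alg_mult A x y) = alg_mult B (h x) (h y)) \<and>
     (\<forall>c. \<forall>x\<in>alg_carrier A. h (alg_scale A c x) = alg_scale B c (h x))"

text \<open>
  Endomorphisms of a subspace \<open>M\<close> are represented by functions that are \<^const>\<open>undefined\<close> outside
  \<open>M\<close>, so that equality of endomorphisms is equality on \<open>M\<close>.
\<close>

definition End_algebra ::
    "('k::field \<Rightarrow> 'm::ab_group_add \<Rightarrow> 'm) \<Rightarrow> 'm set \<Rightarrow> ('k, 'm \<Rightarrow> 'm) nonunital_algebra" where
  "End_algebra scl M = \<lparr>
     alg_carrier = {f \<in> M \<rightarrow>\<^sub>E M.
       (\<forall>x\<in>M. \<forall>y\<in>M. f (x + y) = f x + f y) \<and> (\<forall>c. \<forall>x\<in>M. f (scl c x) = scl c (f x))},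
     alg_add = (\<lambda>f g. \<lambda>x\<in>M. f x + g x),
     alg_mult = (\<lambda>f g. compose M f g),
     alg_scale = (\<lambda>c f. \<lambda>x\<in>M. scl c (f x))\<rparr>"

record ('k, 'a, 'm) rep =
  rep_scale :: "'k \<Rightarrow> 'm \<Rightarrow> 'm"
  rep_space :: "'m set"
  rep_map :: "'a \<Rightarrow> 'm \<Rightarrow> 'm"

definition representation ::
    "('k::field, 'a) nonunital_algebra \<Rightarrow> ('k, 'a, 'm::ab_group_add) rep \<Rightarrow> bool" where
  "representation A V \<longleftrightarrow>
     vector_space (rep_scale V) \<and> module.subspace (rep_scale V) (rep_space V) \<and>
     algebra_hom A (End_algebra (rep_scale V) (rep_space V)) (rep_map V)"

definition faithful_representation ::
    "('k::field, 'a) nonunital_algebra \<Rightarrow> ('k, 'a, 'm::ab_group_add) rep \<Rightarrow> bool" where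
  "faithful_representation A V \<longleftrightarrow> representation A V \<and> inj_on (rep_map V) (alg_carrier A)"

definition rep_sum ::
    "('k, 'a, 'm) rep \<Rightarrow> ('k, 'a, 'n) rep \<Rightarrow> ('k, 'a, 'm \<times> 'n) rep"
    where
  "rep_sum V W = \<lparr>
     rep_scale = (\<lambda>c (x, y). (rep_scale V c x, rep_scale W c y)),
     rep_space = rep_space V \<times> rep_space W,
     rep_map = (\<lambda>a. \<lambda>(x, y)\<in>rep_space V \<times> rep_space W. (rep_map V a x, rep_map W a y))\<rparr>"


section \<open>Algebras given by generators and relations\<close>

text \<open>
  Words in the generators, with concatenation written additively: \<open>'g free_word \<Rightarrow>\<^sub>0 'k\<close> with the
  convolution product of \<^theory>\<open>HOL-Library.Poly_Mapping\<close> is then the free unital \<open>k\<close>-algebra,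
  inside which the free algebra without unit is spanned by the nonempty words.
\<close>

datatype 'g free_word = Word (letters: "'g list")

instantiation free_word :: (type) monoid_add
begin

definition zero_free_word :: "'a free_word" where
  "0 = Word []"

definition plus_free_word :: "'a free_word \<Rightarrow> 'a free_word \<Rightarrow> 'a free_word" where
  "v + w = Word (letters v @ letters w)"

instance
  by standard (simp_all add: zero_free_word_def plus_free_word_def)

end

type_synonym ('g, 'k) free_elem = "'g free_word \<Rightarrow>\<^sub>0 'k"

definition free_algebra :: "'g set \<Rightarrow> ('g, 'k::field) free_elem set" where
  "free_algebra X = space_on {w. letters w \<noteq> [] \<and> set (letters w) \<subseteq> X}"

definition gen :: "'g \<Rightarrow> ('g, 'k::field) free_elem" where
  "gen x = basis_vec (Word [x])"

definition free_ideal :: "'g set \<Rightarrow> ('g, 'k::field) free_elem set \<Rightarrow> bool" where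
  "free_ideal X I \<longleftrightarrow>
     I \<subseteq> free_algebra X \<and> module.subspace pm_scale I \<and>
     (\<forall>a\<in>free_algebra X. \<forall>x\<in>I. a * x \<in> I \<and> x * a \<in> I)"

definition relation_ideal ::
    "'g set \<Rightarrow> ('g, 'k::field) free_elem set \<Rightarrow> ('g, 'k) free_elem set" where
  "relation_ideal X R = free_ideal X hull R"

definition relation_class ::
    "'g set \<Rightarrow> ('g, 'k::field) free_elem set \<Rightarrow> ('g, 'k) free_elem \<Rightarrow> ('g, 'k) free_elem set"
    where
  "relation_class X R a = {b \<in> free_algebra X. b - a \<in> relation_ideal X R}"

text \<open>
  The algebra without unit generated by \<open>X\<close> subject to \<open>r = 0\<close> for all \<open>r\<close> in \<open>R\<close>, where \<open>R\<close> is
  contained in the free algebra on \<open>X\<close>. Its elements are the cosets of the ideal generated by \<open>R\<close>.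
\<close>

definition presented_algebra ::
    "'g set \<Rightarrow> ('g, 'k::field) free_elem set \<Rightarrow> ('k, ('g, 'k) free_elem set) nonunital_algebra"
    where
  "presented_algebra X R = \<lparr>
     alg_carrier = relation_class X R ` free_algebra X,
     alg_add = (\<lambda>S T. \<Union>a\<in>S. \<Union>b\<in>T. relation_class X R (a + b)),
     alg_mult = (\<lambda>S T. \<Union>a\<in>S. \<Union>b\<in>T. relation_class X R (a * b)),
     alg_scale = (\<lambda>c S. \<Union>a\<in>S. relation_class X R (pm_scale c a))\<rparr>"

text \<open>
  An action of the generators on \<open>M\<close> extends to the free algebra (products act as compositions) and,
  if the relations act as zero, to the presented algebra: a coset acts as the common value
  of its members.
\<close>

definition free_action ::
    "('k::field \<Rightarrow> 'm::ab_group_add \<Rightarrow> 'm) \<Rightarrow> ('g \<Rightarrow> 'm \<Rightarrow> 'm) \<Rightarrow> ('g, 'k) free_elem \<Rightarrow> 'm \<Rightarrow> 'm"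
    where
  "free_action scl act a m = linear_ext scl (\<lambda>w. foldr act (letters w) m) a"

definition presented_rep ::
    "('k::field \<Rightarrow> 'm::ab_group_add \<Rightarrow> 'm) \<Rightarrow> 'm set \<Rightarrow> ('g \<Rightarrow> 'm \<Rightarrow> 'm)
      \<Rightarrow> ('k, ('g, 'k) free_elem set, 'm) rep" where
  "presented_rep scl M act = \<lparr>
     rep_scale = scl,
     rep_space = M,
     rep_map = (\<lambda>S. \<lambda>m\<in>M. the_elem ((\<lambda>a. free_action scl act a m) ` S))\<rparr>"


section \<open>Leavitt path algebras\<close>

datatype ('v, 'a) lpa_gen = Vertex 'v | Arrow 'a | Star 'a

definition lpa_gens :: "('v, 'a) pre_digraph \<Rightarrow> ('v, 'a) lpa_gen set" where
  "lpa_gens Q = Vertex ` verts Q \<union> Arrow ` arcs Q \<union> Star ` arcs Q"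

abbreviation vx :: "'v \<Rightarrow> (('v, 'a) lpa_gen, 'k::field) free_elem" where
  "vx i \<equiv> gen (Vertex i)"

abbreviation ar :: "'a \<Rightarrow> (('v, 'a) lpa_gen, 'k::field) free_elem" where
  "ar \<alpha> \<equiv> gen (Arrow \<alpha>)"

abbreviation st :: "'a \<Rightarrow> (('v, 'a) lpa_gen, 'k::field) free_elem" where
  "st \<alpha> \<equiv> gen (Star \<alpha>)"

definition lpa_relations ::
    "('v, 'a) pre_digraph \<Rightarrow> (('v, 'a) lpa_gen, 'k::field) free_elem set" where
  "lpa_relations Q =
     {vx i * vx j - (if i = j then vx i else 0) | i j. i \<in> verts Q \<and> j \<in> verts Q} \<union>
     {vx (head Q \<alpha>) * ar \<alpha> - ar \<alpha> | \<alpha>. \<alpha> \<in> arcs Q} \<union>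
     {ar \<alpha> * vx (tail Q \<alpha>) - ar \<alpha> | \<alpha>. \<alpha> \<in> arcs Q} \<union>
     {vx (tail Q \<alpha>) * st \<alpha> - st \<alpha> | \<alpha>. \<alpha> \<in> arcs Q} \<union>
     {st \<alpha> * vx (head Q \<alpha>) - st \<alpha> | \<alpha>. \<alpha> \<in> arcs Q} \<union>
     {ar \<alpha> * st \<beta> - (if \<alpha> = \<beta> then vx (head Q \<alpha>) else 0) | \<alpha> \<beta>. \<alpha> \<in> arcs Q \<and> \<beta> \<in> arcs Q} \<union>
     {(\<Sum>\<alpha>\<in>out_arcs Q i. st \<alpha> * ar \<alpha>) - vx i | i. regular_vertex Q i}"

definition leavitt_path_algebra ::
    "('v, 'a) pre_digraph \<Rightarrow> ('k::field, (('v, 'a) lpa_gen, 'k) free_elem set) nonunital_algebra"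
    where
  "leavitt_path_algebra Q = presented_algebra (lpa_gens Q) (lpa_relations Q)"


section \<open>The representations \<open>\<F>\<close> and \<open>\<N>\<close>\<close>

fun F_basis_action ::
    "('v, 'a) pre_digraph \<Rightarrow> ('v, 'a) lpa_gen \<Rightarrow> (nat \<Rightarrow> 'a) \<Rightarrow> ((nat \<Rightarrow> 'a) \<Rightarrow>\<^sub>0 'k::field)" where
  "F_basis_action Q (Vertex i) p = (if i = start_inf Q p then basis_vec p else 0)"
| "F_basis_action Q (Arrow \<alpha>) p = (if \<alpha> = p 0 then basis_vec (truncate_inf 1 p) else 0)"
| "F_basis_action Q (Star \<alpha>) p =
     (if head Q \<alpha> = start_inf Q p then basis_vec (case_nat \<alpha> p) else 0)"

definition F_rep ::
    "('v, 'a) pre_digraph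
      \<Rightarrow> ('k::field, (('v, 'a) lpa_gen, 'k) free_elem set, (nat \<Rightarrow> 'a) \<Rightarrow>\<^sub>0 'k) rep" where
  "F_rep Q = presented_rep pm_scale (space_on (left_infinite_paths Q))
     (\<lambda>x. linear_ext pm_scale (F_basis_action Q x))"

fun N_basis_action ::
    "('v, 'a) pre_digraph \<Rightarrow> ('v, 'a) lpa_gen \<Rightarrow> 'v \<times> 'a list \<Rightarrow> ('v \<times> 'a list \<Rightarrow>\<^sub>0 'k::field)" where
  "N_basis_action Q (Vertex i) (u, w) = (if i = u then basis_vec (u, w) else 0)"
| "N_basis_action Q (Arrow \<alpha>) (u, []) = 0"
| "N_basis_action Q (Arrow \<alpha>) (u, \<beta> # w) = (if \<alpha> = \<beta> then basis_vec (head Q \<beta>, w) else 0)"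
| "N_basis_action Q (Star \<alpha>) (u, w) =
     (if head Q \<alpha> = u then basis_vec (tail Q \<alpha>, \<alpha> # w) else 0)"

definition N_rep ::
    "('v, 'a) pre_digraph
      \<Rightarrow> ('k::field, (('v, 'a) lpa_gen, 'k) free_elem set, 'v \<times> 'a list \<Rightarrow>\<^sub>0 'k) rep" where
  "N_rep Q = presented_rep pm_scale (space_on (sink_paths Q))
     (\<lambda>x. linear_ext pm_scale (N_basis_action Q x))"

end

theory Submission
  imports Defs
begin

text \<open>
  Put \<open>p\<^sup>* q\<close> for the element which removes the path \<open>q\<close> and then attaches \<open>p\<close>, where \<open>p\<close> and \<open>q\<close> end at
  the same vertex. The first four relations show that these elements span the algebra.
  Expanding \<open>e\<^sub>v = \<Sum> \<alpha>\<^sup>* \<alpha>\<close> in the middle of \<open>p\<^sup>* q\<close> lengthens \<open>q\<close> as long as \<open>q\<close> does not end at a sink,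
  so every element is a combination \<open>\<Sum> c\<^sub>p\<^sub>q p\<^sup>* q\<close> in which all \<open>q\<close> have a common length \<open>n\<close>, or are shorter
  and end at a sink. Such \<open>q\<close> are pairwise incomparable for the prefix order, so if \<open>b\<close> is a path
  starting where \<open>q\<close> ends, the element sends \<open>b q\<close> to \<open>\<Sum> c\<^sub>p\<^sub>q b p\<close>, summed over \<open>p\<close>. If \<open>b\<close> is a path to a sink
  or a non-cyclic infinite path, then the paths \<open>b p\<close> are pairwise distinct, since \<open>b = b r\<close> with \<open>r\<close>
  nontrivial would make \<open>b\<close> cyclic. Hence an element that acts as zero has all \<open>c\<^sub>p\<^sub>q = 0\<close>.
\<close>

section \<open>Linear maps on spaces with a basis\<close>

lemma lookup_pm_scale [simp]: "Poly_Mapping.lookup (pm_scale c f) b = c * Poly_Mapping.lookup f b"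
  by (simp add: pm_scale_def map.rep_eq when_def)

interpretation pm: vector_space pm_scale
  by standard (auto intro!: poly_mapping_eqI simp: lookup_add algebra_simps)

lemma subspace_space_on: "pm.subspace (space_on B :: ('a \<Rightarrow>\<^sub>0 'b::field) set)"
  unfolding pm.subspace_def
proof (intro conjI ballI allI)
  fix f g :: "'a \<Rightarrow>\<^sub>0 'b" assume "f \<in> space_on B" "g \<in> space_on B"
  then show "f + g \<in> space_on B"
    using keys_add [of f g] by (auto simp: space_on_def)
qed (auto simp: space_on_def in_keys_iff)

lemma basis_vec_in_space_on [simp]: "basis_vec b \<in> (space_on B :: ('b \<Rightarrow>\<^sub>0 'k::field) set) \<longleftrightarrow> b \<in> B"
  by (simp add: basis_vec_def space_on_def)

lemma lookup_basis_vec: "Poly_Mapping.lookup (basis_vec b) c = (if b = c then 1 else 0 :: 'k::field)"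
  by (simp add: basis_vec_def lookup_single when_def)

lemma basis_vec_eq_iff [simp]: "(basis_vec b :: 'b \<Rightarrow>\<^sub>0 'k::field) = basis_vec c \<longleftrightarrow> b = c"
  by (metis lookup_basis_vec zero_neq_one)

lemma basis_vec_nonzero [simp]: "(basis_vec b :: 'b \<Rightarrow>\<^sub>0 'k::field) \<noteq> 0"
  by (metis lookup_basis_vec lookup_zero zero_neq_one)

lemma basis_expansion:
  "f = (\<Sum>b\<in>Poly_Mapping.keys f. pm_scale (Poly_Mapping.lookup f b) (basis_vec b))"
  by (rule poly_mapping_eqI)
    (auto simp: lookup_sum lookup_basis_vec in_keys_iff if_distrib [of "(*) _"] cong: if_cong)

text \<open>The induction principle for spaces with a basis: a condition that cuts out a subspace
  has to be checked on basis vectors only. Equality of linear maps and invariance of subspaces are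
  reduced to bases in this way.\<close>

lemma space_on_subset:
  fixes S :: "('b \<Rightarrow>\<^sub>0 'k::field) set"
  assumes "pm.subspace S" and "\<And>b. b \<in> B \<Longrightarrow> basis_vec b \<in> S"
  shows "space_on B \<subseteq> S"
proof
  fix f :: "'b \<Rightarrow>\<^sub>0 'k" assume "f \<in> space_on B"
  then have "(\<Sum>b\<in>Poly_Mapping.keys f. pm_scale (Poly_Mapping.lookup f b) (basis_vec b)) \<in> S"
    using assms by (intro pm.subspace_sum pm.subspace_scale) (auto simp: space_on_def)
  then show "f \<in> S" using basis_expansion [of f] by simp
qed

lemma zero_in_space_on [simp]: "0 \<in> space_on B"
  by (simp add: space_on_def)

lemma space_on_UNIV [simp]: "space_on UNIV = UNIV"
  by (simp add: space_on_def)

text \<open>The defining sum runs over the support of \<open>f\<close>, which changes under addition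
  and scaling. Summing over a common finite superset makes linearity a termwise computation, since
  the extra terms have coefficient zero.\<close>

lemma linear_ext_eq_sum:
  assumes "vector_space scl" "finite S" "Poly_Mapping.keys f \<subseteq> S"
  shows "linear_ext scl g f = (\<Sum>b\<in>S. scl (Poly_Mapping.lookup f b) (g b))"
proof -
  interpret vector_space scl by fact
  show ?thesis unfolding linear_ext_def
    by (rule sum.mono_neutral_left) (use assms in \<open>auto simp: in_keys_iff\<close>)
qed

lemma linear_linear_ext:
  fixes g :: "'b \<Rightarrow> 'm::ab_group_add" and scl :: "'k::field \<Rightarrow> 'm \<Rightarrow> 'm"
  assumes "vector_space scl"
  shows "Vector_Spaces.linear pm_scale scl (linear_ext scl g)"
proof -
  interpret vector_space scl by fact
  show ?thesis unfolding Vector_Spaces.linear_iff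
  proof (intro conjI allI)
    fix f h :: "'b \<Rightarrow>\<^sub>0 'k"
    let ?S = "Poly_Mapping.keys f \<union> Poly_Mapping.keys h"
    have "Poly_Mapping.keys (f + h) \<subseteq> ?S" by (rule keys_add)
    then show "linear_ext scl g (f + h) = linear_ext scl g f + linear_ext scl g h"
      by (simp add: linear_ext_eq_sum [OF assms, of ?S] lookup_add scale_left_distrib sum.distrib)
  next
    fix c and f :: "'b \<Rightarrow>\<^sub>0 'k"
    have "Poly_Mapping.keys (pm_scale c f) \<subseteq> Poly_Mapping.keys f" by (auto simp: in_keys_iff)
    then show "linear_ext scl g (pm_scale c f) = scl c (linear_ext scl g f)"
      by (simp add: linear_ext_eq_sum [OF assms, of "Poly_Mapping.keys f"] scale_sum_right)
  qed (fact pm.vector_space_axioms assms)+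
qed

lemma linear_ext_basis_vec [simp]:
  assumes "vector_space scl"
  shows "linear_ext scl g (basis_vec b) = g b"
proof -
  interpret vector_space scl by fact
  show ?thesis by (simp add: linear_ext_def basis_vec_def)
qed

lemma linear_eqI_basis:
  assumes f: "Vector_Spaces.linear pm_scale scl f" and g: "Vector_Spaces.linear pm_scale scl g"
    and eq: "\<And>b. b \<in> B \<Longrightarrow> f (basis_vec b) = g (basis_vec b)" and x: "x \<in> space_on B"
  shows "f x = g x"
proof -
  interpret f: Vector_Spaces.linear pm_scale scl f by fact
  interpret g: Vector_Spaces.linear pm_scale scl g by fact
  have "pm.subspace {x. f x = g x}"
    by (simp add: pm.subspace_def f.add g.add f.scale g.scale)
  from space_on_subset [OF this, of B] eq x show ?thesis by auto
qed

lemma linear_maps_space_on: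
  assumes f: "Vector_Spaces.linear pm_scale scl f" and M: "module.subspace scl M"
    and maps: "\<And>b. b \<in> B \<Longrightarrow> f (basis_vec b) \<in> M" and x: "x \<in> space_on B"
  shows "f x \<in> M"
proof -
  interpret Vector_Spaces.linear pm_scale scl f by fact
  have "pm.subspace (f -` M)" using M by (rule subspace_vimage)
  from space_on_subset [OF this, of B] maps x show ?thesis by auto
qed

text \<open>Scalars sit at the neutral element \<open>0\<close> of the monoid, so they commute with
  every element even when the monoid is not commutative. Scaling can therefore be moved past either
  factor of a product.\<close>

lemma pm_scale_conv_times:
  fixes a :: "'w::monoid_add \<Rightarrow>\<^sub>0 'k::field"
  shows "pm_scale c a = Poly_Mapping.single 0 c * a" "pm_scale c a = a * Poly_Mapping.single 0 c"
proof -
  have scale_single: "pm_scale d (Poly_Mapping.single b e) = Poly_Mapping.single b (d * e)"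
    for b :: 'w and d e :: 'k
    by (rule poly_mapping_eqI) (simp add: lookup_single when_def)
  have a: "a = (\<Sum>b\<in>Poly_Mapping.keys a. Poly_Mapping.single b (Poly_Mapping.lookup a b))"
    using basis_expansion [of a] by (simp add: basis_vec_def scale_single)
  show "pm_scale c a = Poly_Mapping.single 0 c * a"
    by (subst (1 2) a) (simp add: pm.scale_sum_right sum_distrib_left scale_single mult_single)
  show "pm_scale c a = a * Poly_Mapping.single 0 c"
    by (subst (1 2) a)
      (simp add: pm.scale_sum_right sum_distrib_right scale_single mult_single mult.commute)
qed

lemma pm_scale_mult_left: "pm_scale c a * b = pm_scale c (a * b)"
  and pm_scale_mult_right: "a * pm_scale c b = pm_scale c (a * b)"
  for a b :: "'w::monoid_add \<Rightarrow>\<^sub>0 'k::field"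
  by (simp_all add: pm_scale_conv_times(1) mult.assoc)
    (metis mult.assoc pm_scale_conv_times)

section \<open>Presented algebras and their representations\<close>

lemma subspace_free_algebra: "pm.subspace (free_algebra X)"
  unfolding free_algebra_def by (rule subspace_space_on)

lemma free_algebra_mult:
  assumes "a \<in> free_algebra X" "b \<in> free_algebra X"
  shows "a * b \<in> free_algebra X"
  using assms keys_mult [of a b]
  by (fastforce simp: free_algebra_def space_on_def plus_free_word_def)

lemma basis_vec_mult:
  "(basis_vec (v + w) :: 'w::monoid_add \<Rightarrow>\<^sub>0 'k::field) = basis_vec v * basis_vec w"
  by (simp add: basis_vec_def mult_single)

text \<open>The operations of the presented algebra are unions over representatives of cosets. As
  soon as all representatives yield the same coset, the union collapses to it, provided that there
  are representatives at all.\<close>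

lemma UN_UN_const:
  assumes "S \<noteq> {}" "T \<noteq> {}" and f: "\<And>x y. x \<in> S \<Longrightarrow> y \<in> T \<Longrightarrow> f x y = C"
  shows "(\<Union>x\<in>S. \<Union>y\<in>T. f x y) = C"
proof -
  have "(\<Union>y\<in>T. f x y) = C" if "x \<in> S" for x
    using assms(2) f [OF that] by (rule SUP_eq_const)
  with assms(1) show ?thesis by (rule SUP_eq_const)
qed

section \<open>The quotient by the ideal of relations\<close>

locale presentation =
  fixes X :: "'g set" and R :: "('g, 'k::field) free_elem set"
  assumes relations: "R \<subseteq> free_algebra X"
begin

text \<open>Ideals are closed under intersection, and the hull is an intersection of ideals. It
  stays inside the free algebra because the free algebra is itself one of the ideals containing
  \<open>R\<close>.\<close>

lemma free_ideal_relation_ideal: "free_ideal X (relation_ideal X R)"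
proof -
  let ?T = "{I. free_ideal X I \<and> R \<subseteq> I}"
  have "free_ideal X (free_algebra X :: ('g, 'k) free_elem set)"
    by (simp add: free_ideal_def subspace_free_algebra free_algebra_mult)
  then have "\<Inter>?T \<subseteq> free_algebra X" using relations by blast
  moreover have "pm.subspace (\<Inter>?T)"
    by (rule pm.subspace_Inter) (auto simp: free_ideal_def)
  ultimately show ?thesis
    unfolding relation_ideal_def hull_def free_ideal_def by blast
qed

lemma subspace_relation_ideal: "pm.subspace (relation_ideal X R)"
  using free_ideal_relation_ideal by (simp add: free_ideal_def)

lemma relation_ideal_mult:
  assumes "a \<in> free_algebra X" "x \<in> relation_ideal X R"
  shows "a * x \<in> relation_ideal X R" "x * a \<in> relation_ideal X R"
  using free_ideal_relation_ideal assms by (auto simp: free_ideal_def)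

lemma relations_in_ideal: "r \<in> R \<Longrightarrow> r \<in> relation_ideal X R"
  unfolding relation_ideal_def by (rule hull_inc)

lemma relation_class_eq_iff:
  assumes "a \<in> free_algebra X" "b \<in> free_algebra X"
  shows "relation_class X R a = relation_class X R b \<longleftrightarrow> a - b \<in> relation_ideal X R"
proof
  assume "relation_class X R a = relation_class X R b"
  moreover have "a \<in> relation_class X R a"
    using assms pm.subspace_0 [OF subspace_relation_ideal] by (simp add: relation_class_def)
  ultimately show "a - b \<in> relation_ideal X R" by (simp add: relation_class_def)
next
  assume *: "a - b \<in> relation_ideal X R"
  have "c - a \<in> relation_ideal X R \<longleftrightarrow> c - b \<in> relation_ideal X R" for c
    using pm.subspace_add [OF subspace_relation_ideal _ *, of "c - a"]
      pm.subspace_diff [OF subspace_relation_ideal _ *, of "c - b"] by auto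
  then show "relation_class X R a = relation_class X R b" by (auto simp: relation_class_def)
qed

lemma relation_class_self: "a \<in> free_algebra X \<Longrightarrow> a \<in> relation_class X R a"
  using pm.subspace_0 [OF subspace_relation_ideal] by (simp add: relation_class_def)

lemma presented_algebra_add:
  assumes "a \<in> free_algebra X" "b \<in> free_algebra X"
  shows "alg_add (presented_algebra X R) (relation_class X R a) (relation_class X R b) =
    relation_class X R (a + b)"
proof -
  have "relation_class X R (a' + b') = relation_class X R (a + b)"
    if "a' \<in> relation_class X R a" "b' \<in> relation_class X R b" for a' b'
  proof (subst relation_class_eq_iff)
    have "(a' - a) + (b' - b) \<in> relation_ideal X R"
      using that by (auto simp: relation_class_def intro: pm.subspace_add [OF subspace_relation_ideal])
    then show "a' + b' - (a + b) \<in> relation_ideal X R" by (simp add: algebra_simps)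
  qed (use that assms in \<open>auto simp: relation_class_def intro: pm.subspace_add [OF subspace_free_algebra]\<close>)
  then show ?thesis
    unfolding presented_algebra_def nonunital_algebra.simps
    by (intro UN_UN_const) (use assms relation_class_self in blast)+
qed

lemma presented_algebra_mult:
  assumes "a \<in> free_algebra X" "b \<in> free_algebra X"
  shows "alg_mult (presented_algebra X R) (relation_class X R a) (relation_class X R b) =
    relation_class X R (a * b)"
proof -
  have "relation_class X R (a' * b') = relation_class X R (a * b)"
    if "a' \<in> relation_class X R a" "b' \<in> relation_class X R b" for a' b'
  proof (subst relation_class_eq_iff)
    have "(a' - a) * b' + a * (b' - b) \<in> relation_ideal X R"
      using that assms
      by (intro pm.subspace_add [OF subspace_relation_ideal] relation_ideal_mult(1) [of a]
          relation_ideal_mult(2) [of b']) (auto simp: relation_class_def)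
    then show "a' * b' - a * b \<in> relation_ideal X R" by (simp add: algebra_simps)
  qed (use that assms in \<open>auto simp: relation_class_def intro: free_algebra_mult\<close>)
  then show ?thesis
    unfolding presented_algebra_def nonunital_algebra.simps
    by (intro UN_UN_const) (use assms relation_class_self in blast)+
qed

lemma presented_algebra_scale:
  assumes "a \<in> free_algebra X"
  shows "alg_scale (presented_algebra X R) c (relation_class X R a) =
    relation_class X R (pm_scale c a)"
proof -
  have "relation_class X R (pm_scale c a') = relation_class X R (pm_scale c a)"
    if "a' \<in> relation_class X R a" for a'
  proof (subst relation_class_eq_iff)
    show "pm_scale c a' - pm_scale c a \<in> relation_ideal X R"
      using pm.subspace_scale [OF subspace_relation_ideal, of "a' - a" c] that
      by (simp add: relation_class_def pm.scale_right_diff_distrib)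
  next
    show "pm_scale c a' \<in> free_algebra X"
      using pm.subspace_scale [OF subspace_free_algebra, of a'] that
      by (simp add: relation_class_def)
  qed (use pm.subspace_scale [OF subspace_free_algebra assms] in simp_all)
  then show ?thesis
    using relation_class_self [OF assms]
    unfolding presented_algebra_def nonunital_algebra.simps by (intro SUP_eq_const) blast+
qed

end

section \<open>The action of the free algebra\<close>

context vector_space
begin

lemma linear_free_action: "Vector_Spaces.linear pm_scale scale (\<lambda>a. free_action scale act a m)"
  unfolding free_action_def by (rule linear_linear_ext) (rule vector_space_axioms)

lemma free_action_basis_vec [simp]:
  "free_action scale act (basis_vec w) m = foldr act (letters w) m"
  unfolding free_action_def by (simp add: vector_space_axioms)

lemma linear_free_action_right:
  assumes "\<And>x. Vector_Spaces.linear scale scale (act x)"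
  shows "Vector_Spaces.linear scale scale (free_action scale act a)"
proof -
  have "Vector_Spaces.linear scale scale (foldr act xs)" for xs
  proof (induction xs)
    case Nil
    show ?case by (simp add: Vector_Spaces.linear_iff vector_space_axioms)
  next
    case (Cons x xs)
    then show ?case using assms [of x] by (simp add: Vector_Spaces.linear_iff)
  qed
  then show ?thesis
    by (simp add: Vector_Spaces.linear_iff free_action_def linear_ext_def scale_right_distrib
        sum.distrib scale_sum_right mult.commute)
qed

text \<open>Both sides are linear in \<open>a\<close> and in \<open>b\<close>, so it suffices to
  compare them on words, where concatenation becomes composition. The extension is made first in
  \<open>b\<close>, with a fixed word on the left, and then in \<open>a\<close>.\<close>

lemma free_action_mult:
  assumes "\<And>x. Vector_Spaces.linear scale scale (act x)"
  shows "free_action scale act (a * b) m = free_action scale act a (free_action scale act b m)"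
proof -
  note lin = linear_free_action linear_free_action_right [of act, OF assms]
  have words: "free_action scale act (basis_vec w * b) m = foldr act (letters w) (free_action scale act b m)"
    for w
  proof (rule linear_eqI_basis [where x = b and B = UNIV])
    show "Vector_Spaces.linear pm_scale scale (\<lambda>b. free_action scale act (basis_vec w * b) m)"
      using lin(1) [of act m] by (simp add: Vector_Spaces.linear_iff distrib_left pm_scale_mult_right)
    show "Vector_Spaces.linear pm_scale scale (\<lambda>b. foldr act (letters w) (free_action scale act b m))"
      using lin(1) [of act m] lin(2) [of "basis_vec w"] by (simp add: Vector_Spaces.linear_iff)
  qed (simp_all flip: basis_vec_mult add: plus_free_word_def)
  show ?thesis
  proof (rule linear_eqI_basis [where x = a and B = UNIV])
    show "Vector_Spaces.linear pm_scale scale (\<lambda>a. free_action scale act (a * b) m)"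
      using lin(1) [of act m] by (simp add: Vector_Spaces.linear_iff distrib_right pm_scale_mult_left)
    show "Vector_Spaces.linear pm_scale scale (\<lambda>a. free_action scale act a (free_action scale act b m))"
      by (rule lin(1))
    show "free_action scale act (basis_vec w * b) m =
        free_action scale act (basis_vec w) (free_action scale act b m)" for w
      by (simp only: words free_action_basis_vec)
  qed simp
qed

end

section \<open>Modules over a presented algebra\<close>

locale presented_module = presentation X R + vs: vector_space scl
  for X :: "'g set" and R :: "('g, 'k::field) free_elem set"
    and scl :: "'k \<Rightarrow> 'm::ab_group_add \<Rightarrow> 'm" +
  fixes M :: "'m set" and act :: "'g \<Rightarrow> 'm \<Rightarrow> 'm"
  assumes subspace: "vs.subspace M"
    and linear_act: "\<And>x. Vector_Spaces.linear scl scl (act x)"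
    and act_in: "\<And>x m. x \<in> X \<Longrightarrow> m \<in> M \<Longrightarrow> act x m \<in> M"
    and relations_act: "\<And>r m. r \<in> R \<Longrightarrow> m \<in> M \<Longrightarrow> free_action scl act r m = 0"
begin

lemma free_action_in:
  assumes "a \<in> free_algebra X" "m \<in> M"
  shows "free_action scl act a m \<in> M"
proof (rule linear_maps_space_on [OF vs.linear_free_action subspace])
  show "a \<in> space_on {w. letters w \<noteq> [] \<and> set (letters w) \<subseteq> X}"
    using assms by (simp add: free_algebra_def)
  have "foldr act xs m \<in> M" if "set xs \<subseteq> X" for xs
    using that by (induction xs) (auto simp: assms(2) act_in)
  then show "free_action scl act (basis_vec w) m \<in> M"
    if "w \<in> {w. letters w \<noteq> [] \<and> set (letters w) \<subseteq> X}" for w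
    using that by simp
qed

text \<open>The elements of the free algebra that annihilate \<open>M\<close> form a two-sided ideal
  containing \<open>R\<close>, hence contain the ideal generated by \<open>R\<close>. Left multiples
  annihilate \<open>M\<close> since every action sends zero to zero, right multiples since the free
  algebra maps \<open>M\<close> into itself.\<close>

lemma relation_ideal_act:
  assumes "a \<in> relation_ideal X R" "m \<in> M"
  shows "free_action scl act a m = 0"
proof -
  let ?K = "{a \<in> free_algebra X. \<forall>m\<in>M. free_action scl act a m = 0}"
  have "?K = free_algebra X \<inter> {a. \<forall>m\<in>M. free_action scl act a m = 0}" by blast
  moreover have "pm.subspace {a. \<forall>m\<in>M. free_action scl act a m = 0}"
    using vs.linear_free_action [of act]
      module_hom.zero [OF Vector_Spaces.linear.axioms(3) [OF vs.linear_free_action [of act]]]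
    unfolding pm.subspace_def Vector_Spaces.linear_iff by simp
  ultimately have "pm.subspace ?K"
    using pm.subspace_inter [OF subspace_free_algebra] by simp
  moreover have "a * x \<in> ?K \<and> x * a \<in> ?K" if "a \<in> free_algebra X" "x \<in> ?K" for a x
    using that linear_act free_action_in [of a]
      module_hom.zero [OF Vector_Spaces.linear.axioms(3) [OF vs.linear_free_action_right [of act a]]]
    by (auto simp: free_algebra_mult vs.free_action_mult)
  ultimately have "free_ideal X ?K" by (auto simp: free_ideal_def)
  then have "relation_ideal X R \<subseteq> ?K"
    unfolding relation_ideal_def using relations relations_act by (intro hull_minimal) auto
  with assms show ?thesis by auto
qed

text \<open>Two members of a coset differ by an element of the ideal, which acts as zero. The values
  over the coset thus form a singleton, from which \<open>the_elem\<close> takes the action of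
  \<open>a\<close>.\<close>

lemma rep_map_class:
  assumes "a \<in> free_algebra X"
  shows "rep_map (presented_rep scl M act) (relation_class X R a) =
    (\<lambda>m\<in>M. free_action scl act a m)"
proof -
  have "(\<lambda>b. free_action scl act b m) ` relation_class X R a = {free_action scl act a m}"
    if "m \<in> M" for m
  proof -
    have "free_action scl act b m = free_action scl act a m" if "b \<in> relation_class X R a" for b
    proof -
      have "free_action scl act ((b - a) + a) m = free_action scl act (b - a) m + free_action scl act a m"
        using vs.linear_free_action [of act m] unfolding Vector_Spaces.linear_iff by blast
      then show ?thesis
        using relation_ideal_act [of "b - a" m] that \<open>m \<in> M\<close> by (simp add: relation_class_def)
    qed
    then have "(\<lambda>b. free_action scl act b m) ` relation_class X R a =
        (\<lambda>b. free_action scl act a m) ` relation_class X R a"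
      by (intro image_cong refl)
    then show ?thesis by (simp only: image_constant [OF relation_class_self [OF assms]])
  qed
  then show ?thesis by (auto simp: presented_rep_def restrict_def)
qed

lemma representation_presented_rep:
  "representation (presented_algebra X R) (presented_rep scl M act)"
proof -
  let ?h = "rep_map (presented_rep scl M act)" and ?c = "relation_class X R"
    and ?f = "free_action scl act"
  note lin = vs.linear_free_action [of act, unfolded Vector_Spaces.linear_iff]
    vs.linear_free_action_right [of act, OF linear_act, unfolded Vector_Spaces.linear_iff]
  have f_add: "?f (a + b) m = ?f a m + ?f b m" and f_scale: "?f (pm_scale c a) m = scl c (?f a m)"
    for a b c m
    using lin(1) [of m] by blast+
  have carrier: "(\<lambda>m\<in>M. ?f a m) \<in> alg_carrier (End_algebra scl M)" if "a \<in> free_algebra X" for a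
    using lin(2) [of a] free_action_in [OF that] vs.subspace_add [OF subspace]
      vs.subspace_scale [OF subspace]
    by (simp add: End_algebra_def)
  have "algebra_hom (presented_algebra X R) (End_algebra scl M) ?h"
    unfolding algebra_hom_def
  proof (intro conjI ballI allI funcsetI)
    fix S assume "S \<in> alg_carrier (presented_algebra X R)"
    then obtain a where S: "S = ?c a" and a: "a \<in> free_algebra X"
      by (auto simp: presented_algebra_def)
    show "?h S \<in> alg_carrier (End_algebra scl M)"
      using carrier [OF a] by (simp only: S rep_map_class [OF a])
    show "?h (alg_scale (presented_algebra X R) c S) = alg_scale (End_algebra scl M) c (?h S)" for c
    proof -
      have "pm_scale c a \<in> free_algebra X" by (rule pm.subspace_scale [OF subspace_free_algebra a])
      then show ?thesis
        by (simp only: S presented_algebra_scale [OF a] rep_map_class a)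
          (auto simp: End_algebra_def f_scale)
    qed
    fix T assume "T \<in> alg_carrier (presented_algebra X R)"
    then obtain b where T: "T = ?c b" and b: "b \<in> free_algebra X"
      by (auto simp: presented_algebra_def)
    have "a + b \<in> free_algebra X" by (rule pm.subspace_add [OF subspace_free_algebra a b])
    then show "?h (alg_add (presented_algebra X R) S T) = alg_add (End_algebra scl M) (?h S) (?h T)"
      by (simp only: S T presented_algebra_add [OF a b] rep_map_class a b)
        (auto simp: End_algebra_def f_add)
    have "a * b \<in> free_algebra X" by (rule free_algebra_mult [OF a b])
    then show "?h (alg_mult (presented_algebra X R) S T) = alg_mult (End_algebra scl M) (?h S) (?h T)"
      by (simp only: S T presented_algebra_mult [OF a b] rep_map_class a b)
        (auto simp: End_algebra_def vs.free_action_mult [OF linear_act] compose_def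
          free_action_in [OF b])
  qed
  then show ?thesis
    by (simp add: representation_def presented_rep_def vs.vector_space_axioms subspace)
qed

end

section \<open>Direct sums of representations\<close>

lemma representation_rep_sum:
  fixes A :: "('k::field, 'a) nonunital_algebra"
    and V :: "('k, 'a, 'm::ab_group_add) rep" and W :: "('k, 'a, 'n::ab_group_add) rep"
  assumes V: "representation A V" and W: "representation A W"
  shows "representation A (rep_sum V W)"
proof -
  interpret V: vector_space "rep_scale V" using V by (simp add: representation_def)
  interpret W: vector_space "rep_scale W" using W by (simp add: representation_def)
  have vs: "vector_space (rep_scale (rep_sum V W))"
    by standard (auto simp: rep_sum_def V.scale_right_distrib W.scale_right_distrib
        V.scale_left_distrib W.scale_left_distrib)
  interpret S: vector_space "rep_scale (rep_sum V W)" by (rule vs)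
  let ?M = "rep_space V" and ?N = "rep_space W"
  have M: "V.subspace ?M" and N: "W.subspace ?N"
    and homV: "algebra_hom A (End_algebra (rep_scale V) ?M) (rep_map V)"
    and homW: "algebra_hom A (End_algebra (rep_scale W) ?N) (rep_map W)"
    using V W by (simp_all add: representation_def)
  have sum_simps [simp]: "rep_space (rep_sum V W) = ?M \<times> ?N"
    "rep_scale (rep_sum V W) c (x, y) = (rep_scale V c x, rep_scale W c y)"
    "rep_map (rep_sum V W) a = (\<lambda>(x, y)\<in>?M \<times> ?N. (rep_map V a x, rep_map W a y))" for a c x y
    by (simp_all add: rep_sum_def)
  have sub: "S.subspace (?M \<times> ?N)"
    unfolding S.subspace_def
  proof (intro conjI ballI allI)
    fix c z z' assume "z \<in> ?M \<times> ?N" "z' \<in> ?M \<times> ?N"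
    then obtain x y x' y' where z: "z = (x, y)" "z' = (x', y')" "x \<in> ?M" "y \<in> ?N" "x' \<in> ?M" "y' \<in> ?N"
      by blast
    show "z + z' \<in> ?M \<times> ?N"
      using z V.subspace_add [OF M, of x x'] W.subspace_add [OF N, of y y'] by simp
    show "rep_scale (rep_sum V W) c z \<in> ?M \<times> ?N"
      using z V.subspace_scale [OF M, of x] W.subspace_scale [OF N, of y] by simp
  qed (use V.subspace_0 [OF M] W.subspace_0 [OF N] in \<open>simp add: zero_prod_def\<close>)
  have V_in: "rep_map V a \<in> alg_carrier (End_algebra (rep_scale V) ?M)"
    and W_in: "rep_map W a \<in> alg_carrier (End_algebra (rep_scale W) ?N)"
    if "a \<in> alg_carrier A" for a
    using homV homW that by (auto simp: algebra_hom_def)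
  have "algebra_hom A (End_algebra (rep_scale (rep_sum V W)) (?M \<times> ?N)) (rep_map (rep_sum V W))"
    unfolding algebra_hom_def
  proof (intro conjI ballI allI funcsetI)
    fix a assume a: "a \<in> alg_carrier A"
    show "rep_map (rep_sum V W) a \<in> alg_carrier (End_algebra (rep_scale (rep_sum V W)) (?M \<times> ?N))"
      using V_in [OF a] W_in [OF a] V.subspace_add [OF M] W.subspace_add [OF N]
        V.subspace_scale [OF M] W.subspace_scale [OF N]
      by (auto simp: End_algebra_def PiE_iff split: prod.splits)
    show "rep_map (rep_sum V W) (alg_scale A c a) =
        alg_scale (End_algebra (rep_scale (rep_sum V W)) (?M \<times> ?N)) c (rep_map (rep_sum V W) a)" for c
      using homV homW a by (auto simp: algebra_hom_def End_algebra_def restrict_def fun_eq_iff)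
    fix b assume b: "b \<in> alg_carrier A"
    show "rep_map (rep_sum V W) (alg_add A a b) =
        alg_add (End_algebra (rep_scale (rep_sum V W)) (?M \<times> ?N))
          (rep_map (rep_sum V W) a) (rep_map (rep_sum V W) b)"
      using homV homW a b by (auto simp: algebra_hom_def End_algebra_def restrict_def fun_eq_iff)
    \<comment> \<open>The restricted map of \<open>a\<close> has the right values only on the
      product of the two spaces, so in a composite the inner values must be known to lie
      there.\<close>
    have "rep_map V b x \<in> ?M" "rep_map W b y \<in> ?N" if "x \<in> ?M" "y \<in> ?N" for x y
      using V_in [OF b] W_in [OF b] that by (auto simp: End_algebra_def)
    then show "rep_map (rep_sum V W) (alg_mult A a b) =
        alg_mult (End_algebra (rep_scale (rep_sum V W)) (?M \<times> ?N))
          (rep_map (rep_sum V W) a) (rep_map (rep_sum V W) b)"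
      using homV homW a b
      by (auto simp: algebra_hom_def End_algebra_def compose_def restrict_def fun_eq_iff)
  qed
  with vs sub show ?thesis by (simp add: representation_def)
qed

section \<open>Modules with a basis of paths\<close>

lemma gen_in_free_algebra [simp]: "(gen x :: ('g, 'k::field) free_elem) \<in> free_algebra X \<longleftrightarrow> x \<in> X"
  by (simp add: gen_def free_algebra_def)

lemma lpa_gens_iff [simp]:
  "Vertex i \<in> lpa_gens Q \<longleftrightarrow> i \<in> verts Q"
  "Arrow \<alpha> \<in> lpa_gens Q \<longleftrightarrow> \<alpha> \<in> arcs Q"
  "Star \<alpha> \<in> lpa_gens Q \<longleftrightarrow> \<alpha> \<in> arcs Q"
  by (auto simp: lpa_gens_def)

lemma lpa_relations_subset:
  assumes "wf_digraph Q"
  shows "lpa_relations Q \<subseteq> (free_algebra (lpa_gens Q) :: (('v, 'a) lpa_gen, 'k::field) free_elem set)"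
proof -
  interpret wf_digraph Q by fact
  let ?F = "free_algebra (lpa_gens Q) :: (('v, 'a) lpa_gen, 'k) free_elem set"
  have sub: "pm.subspace ?F" by (rule subspace_free_algebra)
  note closed = pm.subspace_0 [OF sub] pm.subspace_diff [OF sub] pm.subspace_sum [OF sub]
    free_algebra_mult [of _ "lpa_gens Q"]
  have CK: "(\<Sum>\<alpha>\<in>out_arcs Q i. st \<alpha> * ar \<alpha>) - vx i \<in> ?F" if "regular_vertex Q i" for i
    using that by (intro closed) (auto simp: regular_vertex_def)
  show ?thesis
    unfolding lpa_relations_def Un_subset_iff
    by (intro conjI subsetI; elim CollectE exE conjE; simp add: closed CK)
qed

text \<open>What the two representations have in common. The paths in \<open>B\<close> are the
  basis, and \<open>cons \<alpha> b\<close> runs through \<alpha> first and then through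
  \<open>b\<close>. Every path either starts at a sink and is annihilated by all arrows, as the
  trivial paths at sinks are, or has a first arrow.\<close>

locale path_module = wf_digraph Q
  for Q :: "('v, 'a) pre_digraph" +
  fixes B :: "'b set" and start :: "'b \<Rightarrow> 'v" and cons :: "'a \<Rightarrow> 'b \<Rightarrow> 'b"
    and act :: "('v, 'a) lpa_gen \<Rightarrow> 'b \<Rightarrow> ('b \<Rightarrow>\<^sub>0 'k::field)"
  assumes cons_in: "\<And>\<alpha> b. b \<in> B \<Longrightarrow> \<alpha> \<in> arcs Q \<Longrightarrow> head Q \<alpha> = start b \<Longrightarrow> cons \<alpha> b \<in> B"
    and start_cons: "\<And>\<alpha> b. b \<in> B \<Longrightarrow> \<alpha> \<in> arcs Q \<Longrightarrow> head Q \<alpha> = start b \<Longrightarrow> start (cons \<alpha> b) = tail Q \<alpha>"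
    and B_cases: "\<And>b. b \<in> B \<Longrightarrow> (sink Q (start b) \<and> (\<forall>\<alpha>. act (Arrow \<alpha>) b = 0)) \<or>
      (\<exists>\<alpha>\<in>arcs Q. \<exists>c\<in>B. head Q \<alpha> = start c \<and> b = cons \<alpha> c)"
    and act_Vertex: "\<And>i b. b \<in> B \<Longrightarrow> act (Vertex i) b = (if i = start b then basis_vec b else 0)"
    and act_Arrow: "\<And>\<alpha> \<beta> b. b \<in> B \<Longrightarrow> \<beta> \<in> arcs Q \<Longrightarrow> head Q \<beta> = start b \<Longrightarrow>
      act (Arrow \<alpha>) (cons \<beta> b) = (if \<alpha> = \<beta> then basis_vec b else 0)"
    and act_Star: "\<And>\<alpha> b. b \<in> B \<Longrightarrow> \<alpha> \<in> arcs Q \<Longrightarrow>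
      act (Star \<alpha>) b = (if head Q \<alpha> = start b then basis_vec (cons \<alpha> b) else 0)"
begin

abbreviation "ext x \<equiv> linear_ext pm_scale (act x)"
abbreviation "action \<equiv> free_action pm_scale ext"

lemma linear_ext: "Vector_Spaces.linear pm_scale pm_scale (ext x)"
  by (rule linear_linear_ext) (rule pm.vector_space_axioms)

lemma ext_basis_vec [simp]: "ext x (basis_vec b) = act x b"
  by (rule linear_ext_basis_vec) (rule pm.vector_space_axioms)

lemma ext_zero [simp]: "ext x 0 = 0"
  by (simp add: linear_ext_def)

lemma foldr_ext_zero [simp]: "foldr ext xs 0 = 0"
  by (induction xs) simp_all

lemma action_gen [simp]: "action (gen x) m = ext x m"
  by (simp add: gen_def)

lemma action_mult [simp]: "action (a * b) m = action a (action b m)"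
  by (rule pm.free_action_mult) (rule linear_ext)

lemma action_zero [simp]: "action 0 m = 0"
  by (simp add: free_action_def linear_ext_def)

lemma action_diff [simp]: "action (a - b) m = action a m - action b m"
proof -
  interpret Vector_Spaces.linear pm_scale pm_scale "\<lambda>a. action a m"
    by (rule pm.linear_free_action)
  show ?thesis by (rule diff)
qed

lemma action_sum [simp]: "action (sum a I) m = (\<Sum>i\<in>I. action (a i) m)"
proof -
  interpret Vector_Spaces.linear pm_scale pm_scale "\<lambda>a. action a m"
    by (rule pm.linear_free_action)
  show ?thesis by (rule sum)
qed

text \<open>If \<open>b\<close> begins with \<beta>, only the summand for \<beta> can be nonzero: it
  removes \<beta> and puts it back, and it occurs exactly if \<open>b\<close> starts at
  \<open>i\<close>. If \<open>b\<close> starts at a sink, every summand vanishes, and so does the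
  right side because a regular vertex is no sink.\<close>

lemma Cuntz_Krieger:
  assumes i: "regular_vertex Q i" and b: "b \<in> B"
  shows "(\<Sum>\<alpha>\<in>out_arcs Q i. ext (Star \<alpha>) (act (Arrow \<alpha>) b)) = act (Vertex i) b"
  using B_cases [OF b]
proof (elim disjE bexE conjE)
  assume "sink Q (start b)" "\<forall>\<alpha>. act (Arrow \<alpha>) b = 0"
  then show ?thesis using i b by (auto simp: act_Vertex regular_vertex_def)
next
  fix \<beta> c assume \<beta>: "\<beta> \<in> arcs Q" and c: "c \<in> B" "head Q \<beta> = start c" and b': "b = cons \<beta> c"
  have start: "start b = tail Q \<beta>" using start_cons c \<beta> b' by simp
  have "finite (out_arcs Q i)"
    using i by (simp add: regular_vertex_def infinite_emitter_def)
  moreover have "ext (Star \<alpha>) (act (Arrow \<alpha>) b) = (if \<alpha> = \<beta> then basis_vec b else 0)" for \<alpha>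
    using \<beta> c by (simp add: b' act_Arrow act_Star)
  ultimately show ?thesis using \<beta> start b by (auto simp: act_Vertex)
qed

lemma relations_act_basis:
  assumes r: "r \<in> lpa_relations Q" and b: "b \<in> B"
  shows "action r (basis_vec b) = 0"
proof -
  \<comment> \<open>An arrow either annihilates \<open>b\<close> or is its first arrow and gets
    removed. The relations between an arrow and the vertices at its two ends follow from this
    alternative.\<close>
  have arrow: "act (Arrow \<alpha>) b = 0 \<or>
      (\<exists>c\<in>B. start b = tail Q \<alpha> \<and> start c = head Q \<alpha> \<and> act (Arrow \<alpha>) b = basis_vec c)"
    for \<alpha>
    using B_cases [OF b]
  proof (elim disjE bexE conjE)
    fix \<beta> c assume "\<beta> \<in> arcs Q" "c \<in> B" "head Q \<beta> = start c" "b = cons \<beta> c"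
    then show ?thesis by (auto simp: act_Arrow start_cons)
  qed simp
  have head: "ext (Vertex (head Q \<alpha>)) (act (Arrow \<alpha>) b) = act (Arrow \<alpha>) b" for \<alpha>
    using arrow [of \<alpha>] by (auto simp: act_Vertex)
  have tail: "act (Arrow \<alpha>) b = 0" if "tail Q \<alpha> \<noteq> start b" for \<alpha>
    using arrow [of \<alpha>] that by auto
  show ?thesis
    using r unfolding lpa_relations_def
    by (elim UnE CollectE exE conjE)
      (simp_all add: head tail b Cuntz_Krieger act_Vertex act_Star act_Arrow cons_in start_cons)
qed

sublocale presented_module "lpa_gens Q" "lpa_relations Q" pm_scale "space_on B" ext
proof (intro presented_module.intro presentation.intro presented_module_axioms.intro)
  show "vector_space (pm_scale :: 'k \<Rightarrow> ('b \<Rightarrow>\<^sub>0 'k) \<Rightarrow> _)"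
    by (rule pm.vector_space_axioms)
  show "lpa_relations Q \<subseteq> (free_algebra (lpa_gens Q) :: (('v, 'a) lpa_gen, 'k) free_elem set)"
    by (rule lpa_relations_subset) (rule wf_digraph_axioms)
  show "pm.subspace (space_on B :: ('b \<Rightarrow>\<^sub>0 'k) set)"
    by (rule subspace_space_on)
  show "Vector_Spaces.linear pm_scale pm_scale (ext x)" for x
    by (rule linear_ext)
next
  fix x and m :: "'b \<Rightarrow>\<^sub>0 'k" assume x: "x \<in> lpa_gens Q" and m: "m \<in> space_on B"
  have "act x b \<in> space_on B" if b: "b \<in> B" for b
  proof (cases x)
    case (Arrow \<alpha>)
    show ?thesis
      using B_cases [OF b]
    proof (elim disjE bexE conjE)
      fix \<beta> c assume "\<beta> \<in> arcs Q" "c \<in> B" "head Q \<beta> = start c" "b = cons \<beta> c"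
      then show ?thesis by (simp add: Arrow act_Arrow)
    qed (simp add: Arrow)
  qed (use x b in \<open>simp_all add: act_Vertex act_Star cons_in\<close>)
  then show "ext x m \<in> space_on B"
    using linear_maps_space_on [OF linear_ext subspace_space_on _ m] by simp
next
  fix r :: "(('v, 'a) lpa_gen, 'k) free_elem" and m :: "'b \<Rightarrow>\<^sub>0 'k"
  assume r: "r \<in> lpa_relations Q" and m: "m \<in> space_on B"
  have "Vector_Spaces.linear pm_scale pm_scale (\<lambda>_. 0 :: 'b \<Rightarrow>\<^sub>0 'k)"
    by (simp add: Vector_Spaces.linear_iff pm.vector_space_axioms)
  from pm.linear_free_action_right [of ext, OF linear_ext] this relations_act_basis [OF r] m
  show "action r m = 0" by (rule linear_eqI_basis)
qed

section \<open>Prefixed paths and the coefficients of normal words\<close>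

lemma foldr_cons:
  assumes "b \<in> B" "awalk u p (start b)"
  shows "foldr cons p b \<in> B" "start (foldr cons p b) = u"
proof -
  have "foldr cons p b \<in> B \<and> start (foldr cons p b) = u"
    using assms(2)
    by (induction p arbitrary: u) (auto simp: awalk_Nil_iff awalk_Cons_iff assms(1) cons_in start_cons)
  then show "foldr cons p b \<in> B" "start (foldr cons p b) = u" by auto
qed

text \<open>The arrow action recovers what was prefixed: applying \<open>Arrow \<alpha>\<close> to
  the common path gives the nonzero vector of \<open>b\<close> on one side, and on the other side
  zero unless the arrows agree.\<close>

lemma cons_eqD:
  assumes "b \<in> B" "\<alpha> \<in> arcs Q" "head Q \<alpha> = start b" and "c \<in> B" "\<beta> \<in> arcs Q" "head Q \<beta> = start c"
    and "cons \<alpha> b = cons \<beta> c"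
  shows "\<alpha> = \<beta>" "b = c"
proof -
  have "(basis_vec b :: 'b \<Rightarrow>\<^sub>0 'k) = (if \<alpha> = \<beta> then basis_vec c else 0)"
    using act_Arrow [of b \<alpha> \<alpha>] act_Arrow [of c \<beta> \<alpha>] assms by simp
  then show "\<alpha> = \<beta>" "b = c" by (auto split: if_splits)
qed

text \<open>Common first arrows of \<open>p\<close> and \<open>p'\<close> are removed until one of
  them is used up. The rest \<open>r\<close> of the other then satisfies
  \<open>foldr cons r b = b\<close>; comparing starting vertices shows that \<open>r\<close> is a
  closed walk at the start of \<open>b\<close>, so \<open>aper\<close> makes it trivial.\<close>

lemma foldr_cons_inject:
  assumes b: "b \<in> B" and aper: "\<And>r. awalk (start b) r (start b) \<Longrightarrow> foldr cons r b = b \<Longrightarrow> r = []"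
    and "awalk u p (start b)" "awalk u' p' (start b)" "foldr cons p b = foldr cons p' b"
  shows "p = p'"
  using assms(3-5)
proof (induction p arbitrary: p' u u')
  case Nil
  then show ?case using aper [of p'] foldr_cons(2) [OF b, of u' p'] by (cases p') auto
next
  case (Cons \<alpha> p)
  show ?case
  proof (cases p')
    case Nil
    then show ?thesis using Cons.prems aper [of "\<alpha> # p"] foldr_cons(2) [OF b, of u "\<alpha> # p"] by auto
  next
    case (Cons \<beta> p'')
    note p' = this
    have walks: "\<alpha> \<in> arcs Q" "awalk (head Q \<alpha>) p (start b)" "\<beta> \<in> arcs Q" "awalk (head Q \<beta>) p'' (start b)"
      using Cons.prems p' by (auto simp: awalk_Cons_iff)
    have "\<alpha> = \<beta>" "foldr cons p b = foldr cons p'' b"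
      using cons_eqD [of "foldr cons p b" \<alpha> "foldr cons p'' b" \<beta>] walks Cons.prems p' foldr_cons [OF b]
      by auto
    then show ?thesis using Cons.IH [of "head Q \<alpha>" "head Q \<beta>" p''] walks p' by auto
  qed
qed

end

text \<open>The rightmost letter acts first. Hence \<open>q\<close> is reversed, its first arrow
  being removed first, while \<open>p\<close> is not, its last arrow being attached first. The
  vertex in the middle keeps the word nonempty when both paths are trivial.\<close>

definition path_word :: "'a list \<Rightarrow> 'v \<Rightarrow> 'a list \<Rightarrow> ('v, 'a) lpa_gen free_word" where
  "path_word p v q = Word (map Star p @ Vertex v # map Arrow (rev q))"

definition normal_words :: "('v, 'a) pre_digraph \<Rightarrow> nat \<Rightarrow> ('v, 'a) lpa_gen free_word set" where
  "normal_words Q n = {path_word p v q | p v q.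
     (\<exists>u. pre_digraph.awalk Q u p v) \<and> (\<exists>u. pre_digraph.awalk Q u q v) \<and>
     (length q = n \<or> length q < n \<and> sink Q v)}"

context path_module
begin

lemma stars_act:
  assumes "b \<in> B" "awalk u p (start b)"
  shows "foldr ext (map Star p) (basis_vec b) = basis_vec (foldr cons p b)"
  using assms(2)
  by (induction p arbitrary: u)
    (auto simp: awalk_Cons_iff act_Star foldr_cons [OF assms(1)])

text \<open>The admissible words \<open>q\<close> form an antichain for the prefix order.\<close>

lemma arrows_act:
  assumes b: "b \<in> B" and "awalk u q (start b)" "length q = n \<or> length q < n \<and> sink Q (start b)"
    and "awalk u' q' v'" "length q' = n \<or> length q' < n \<and> sink Q v'"
  shows "foldr ext (Vertex v' # map Arrow (rev q')) (basis_vec (foldr cons q b)) =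
    (if q' = q \<and> v' = start b then basis_vec b else 0)"
  using assms(2-5)
proof (induction q' arbitrary: q n u u')
  case Nil
  show ?case
  proof (cases q)
    case Nil
    then show ?thesis using b by (simp add: act_Vertex)
  next
    case (Cons \<alpha> q2)
    \<comment> \<open>Here \<open>q\<close> is nontrivial, so \<open>n\<close> is positive and the
      trivial path \<open>q'\<close> is one of the short ones, which end at a sink. The path
      \<open>q\<close> leaves its start, so that start is not \<open>v'\<close>.\<close>
    then have "sink Q v'" "\<alpha> \<in> arcs Q" "tail Q \<alpha> = u" using Nil.prems by (auto simp: awalk_Cons_iff)
    then have "v' \<noteq> u" by (auto simp: sink_def)
    then show ?thesis using Cons foldr_cons [OF b Nil.prems(1)] by (auto simp: act_Vertex)
  qed
next
  case (Cons \<alpha> q')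
  show ?case
  proof (cases q)
    case Nil
    \<comment> \<open>The mirror case: \<open>q\<close> is trivial and \<open>n\<close> is positive,
      so \<open>b\<close> starts at a sink and the first arrow of the other path annihilates
      it.\<close>
    then have "sink Q (start b)" using Cons.prems by auto
    then have "act (Arrow \<alpha>) b = 0"
      using B_cases [OF b] by (auto simp: sink_def start_cons)
    then show ?thesis using Nil by simp
  next
    case (Cons \<beta> q2)
    have walks: "\<beta> \<in> arcs Q" "awalk (head Q \<beta>) q2 (start b)" "awalk (head Q \<alpha>) q' v'"
      using Cons.prems Cons by (auto simp: awalk_Cons_iff)
    have "act (Arrow \<alpha>) (foldr cons q b) = (if \<alpha> = \<beta> then basis_vec (foldr cons q2 b) else 0)"
      using Cons walks foldr_cons [OF b walks(2)] by (simp add: act_Arrow)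
    \<comment> \<open>Since \<open>q\<close> is nonempty, \<open>n\<close> is positive and the
      subtraction is exact; removing one arrow from both paths lowers the level by one.\<close>
    moreover have "length q2 = n - 1 \<or> length q2 < n - 1 \<and> sink Q (start b)"
      using Cons.prems(2) Cons by auto
    moreover have "length q' = n - 1 \<or> length q' < n - 1 \<and> sink Q v'"
      using Cons.prems(4) by auto
    ultimately show ?thesis
      using Cons.IH [of "head Q \<beta>" q2 "n - 1" "head Q \<alpha>"] walks by (cases "\<alpha> = \<beta>") (auto simp: Cons)
  qed
qed

text \<open>The element \<open>y\<close> is applied to the path \<open>q\<close> followed by
  \<open>b\<close>. Only words with the same \<open>q\<close> and the same middle vertex survive,
  and each replaces \<open>q\<close> by its own left path. By \<open>aper\<close> the results are
  distinct basis paths, so the coefficient at \<open>p\<close> followed by \<open>b\<close> is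
  exactly the one sought.\<close>

lemma coefficient_zero:
  assumes y: "y \<in> space_on (normal_words Q n)" "\<And>m. m \<in> space_on B \<Longrightarrow> action y m = 0"
    and p: "awalk u p (start b)" and q: "awalk u' q (start b)"
    and n: "length q = n \<or> length q < n \<and> sink Q (start b)"
    and b: "b \<in> B" and aper: "\<And>r. awalk (start b) r (start b) \<Longrightarrow> foldr cons r b = b \<Longrightarrow> r = []"
  shows "Poly_Mapping.lookup y (path_word p (start b) q) = 0"
proof -
  let ?w = "path_word p (start b) q" and ?c = "foldr cons q b"
  have val: "foldr ext (letters (path_word p' v' q')) (basis_vec ?c) =
      (if q' = q \<and> v' = start b then basis_vec (foldr cons p' b) else 0)"
    if "awalk s p' v'" "awalk s' q' v'" "length q' = n \<or> length q' < n \<and> sink Q v'" for p' v' q' s s'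
    using arrows_act [OF b q n that(2,3)] stars_act [OF b, of s p'] that(1)
    by (auto simp: path_word_def)
  have coeff: "Poly_Mapping.lookup (foldr ext (letters w) (basis_vec ?c)) (foldr cons p b) =
      (if w = ?w then 1 else 0)" if w: "w \<in> Poly_Mapping.keys y" for w
  proof (cases "w = ?w")
    case True
    then show ?thesis using val [OF p q n] by (simp add: lookup_basis_vec)
  next
    case False
    have "w \<in> normal_words Q n" using w y(1) by (auto simp: space_on_def)
    then obtain p' v' q' s s' where w': "w = path_word p' v' q'" and walks: "awalk s p' v'" "awalk s' q' v'"
      "length q' = n \<or> length q' < n \<and> sink Q v'"
      by (auto simp: normal_words_def)
    \<comment> \<open>Either the word has a different \<open>q'\<close> or \<open>v'\<close> and its
      value is zero, or it differs only in \<open>p'\<close> and its value is another basis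
      path.\<close>
    then show ?thesis
      using val [OF walks] False foldr_cons_inject [OF b aper, of s p' u p] p
      by (auto simp: lookup_basis_vec)
  qed
  have "action y (basis_vec ?c) = 0"
    using y(2) foldr_cons [OF b q] by simp
  then have "0 = Poly_Mapping.lookup (action y (basis_vec ?c)) (foldr cons p b)" by simp
  also have "\<dots> = (\<Sum>w\<in>Poly_Mapping.keys y. Poly_Mapping.lookup y w * (if w = ?w then 1 else 0))"
    unfolding free_action_def linear_ext_def [of _ _ y]
    by (auto simp: lookup_sum coeff intro!: sum.cong)
  also have "\<dots> = Poly_Mapping.lookup y ?w"
    by (auto simp: in_keys_iff if_distrib [of "(*) _"] cong: if_cong)
  finally show ?thesis by simp
qed

end

section \<open>Normal forms in the Leavitt path algebra\<close>

definition word :: "'g list \<Rightarrow> ('g, 'k::field) free_elem" where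
  "word xs = basis_vec (Word xs)"

lemma word_append: "word (xs @ ys) = word xs * word ys"
  by (simp add: word_def flip: basis_vec_mult add: plus_free_word_def)

lemma word_Nil [simp]: "word [] = 1"
  by (simp add: word_def basis_vec_def zero_free_word_def [symmetric])

lemma gen_conv_word: "gen x = word [x]"
  by (simp add: gen_def word_def)

lemma word_in_free_algebra: "xs \<noteq> [] \<Longrightarrow> set xs \<subseteq> X \<Longrightarrow> word xs \<in> free_algebra X"
  by (simp add: word_def free_algebra_def)

section \<open>Congruence modulo the relations\<close>

context presentation
begin

definition congruent :: "('g, 'k) free_elem \<Rightarrow> ('g, 'k) free_elem \<Rightarrow> bool" (infix \<open>\<doteq>\<close> 50) where
  "a \<doteq> b \<longleftrightarrow> a - b \<in> relation_ideal X R"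

lemma congruent_refl [simp]: "a \<doteq> a"
  by (simp add: congruent_def pm.subspace_0 [OF subspace_relation_ideal])

lemma congruent_sym: "a \<doteq> b \<Longrightarrow> b \<doteq> a"
  using pm.subspace_neg [OF subspace_relation_ideal, of "a - b"] by (simp add: congruent_def)

lemma congruent_trans [trans]: "a \<doteq> b \<Longrightarrow> b \<doteq> c \<Longrightarrow> a \<doteq> c"
  using pm.subspace_add [OF subspace_relation_ideal, of "a - b" "b - c"] by (simp add: congruent_def)

lemma congruent_add: "a \<doteq> b \<Longrightarrow> c \<doteq> d \<Longrightarrow> a + c \<doteq> b + d"
  using pm.subspace_add [OF subspace_relation_ideal, of "a - b" "c - d"]
  by (simp add: congruent_def algebra_simps)

lemma congruent_scale: "a \<doteq> b \<Longrightarrow> pm_scale c a \<doteq> pm_scale c b"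
  using pm.subspace_scale [OF subspace_relation_ideal, of "a - b" c]
  by (simp add: congruent_def pm.scale_right_diff_distrib)

lemma congruent_sum: "(\<And>i. i \<in> I \<Longrightarrow> a i \<doteq> b i) \<Longrightarrow> sum a I \<doteq> sum b I"
  by (induction I rule: infinite_finite_induct) (simp_all add: congruent_add)

text \<open>The ideal absorbs factors from the free algebra without unit. An empty context is the
  unit \<open>1\<close>, which lies outside that algebra and is therefore treated
  separately.\<close>

lemma congruent_word_mult:
  assumes "a \<doteq> b" "set us \<subseteq> X" "set vs \<subseteq> X"
  shows "word us * a * word vs \<doteq> word us * b * word vs"
proof -
  have "word us * (a - b) \<in> relation_ideal X R"
    using assms word_in_free_algebra [of us X]
    by (cases "us = []") (auto simp: congruent_def intro: relation_ideal_mult)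
  then have "word us * (a - b) * word vs \<in> relation_ideal X R"
    using assms word_in_free_algebra [of vs X]
    by (cases "vs = []") (auto intro: relation_ideal_mult)
  then show ?thesis by (simp add: congruent_def algebra_simps)
qed

lemma congruent_relation:
  "a - b \<in> R \<Longrightarrow> set us \<subseteq> X \<Longrightarrow> set vs \<subseteq> X \<Longrightarrow> word us * a * word vs \<doteq> word us * b * word vs"
  by (rule congruent_word_mult) (simp_all add: congruent_def relations_in_ideal)

end

text \<open>The parameter \<open>field_type\<close> names the coefficient field \<open>'k\<close>,
  which the type of the quiver does not mention; all congruences in this locale are over this one
  field.\<close>

locale leavitt = wf_digraph Q + presentation "lpa_gens Q" "lpa_relations Q :: (_, 'k) free_elem set"
  for Q :: "('v, 'a) pre_digraph" and field_type :: "'k::field itself" +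
  assumes row_finite: "row_finite Q"
begin

abbreviation gens_list :: "('v, 'a) lpa_gen list \<Rightarrow> bool" where
  "gens_list xs \<equiv> set xs \<subseteq> lpa_gens Q"

abbreviation lpa_congruent ::
    "(('v, 'a) lpa_gen, 'k) free_elem \<Rightarrow> (('v, 'a) lpa_gen, 'k) free_elem \<Rightarrow> bool" (infix \<open>\<doteq>\<close> 50)
  where "a \<doteq> b \<equiv> congruent a b"

abbreviation W :: "('v, 'a) lpa_gen list \<Rightarrow> (('v, 'a) lpa_gen, 'k) free_elem" where
  "W \<equiv> word"

section \<open>The defining relations as congruences between words\<close>

lemma vertex_vertex:
  assumes "i \<in> verts Q" "j \<in> verts Q" "gens_list us" "gens_list vs"
  shows "W (us @ Vertex i # Vertex j # vs) \<doteq> (if i = j then W (us @ Vertex i # vs) else 0)"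
proof -
  have "vx i * vx j - (if i = j then vx i else 0) \<in> (lpa_relations Q :: (_, 'k) free_elem set)"
    unfolding lpa_relations_def using assms(1,2) by blast
  from congruent_relation [OF this assms(3,4)] show ?thesis
    by (cases "i = j") (simp_all add: gen_conv_word flip: word_append)
qed

lemma head_arrow:
  assumes "\<alpha> \<in> arcs Q" "gens_list us" "gens_list vs"
  shows "W (us @ Vertex (head Q \<alpha>) # Arrow \<alpha> # vs) \<doteq> W (us @ Arrow \<alpha> # vs)"
proof -
  have "vx (head Q \<alpha>) * ar \<alpha> - ar \<alpha> \<in> (lpa_relations Q :: (_, 'k) free_elem set)"
    unfolding lpa_relations_def using assms(1) by blast
  from congruent_relation [OF this assms(2,3)] show ?thesis
    by (simp add: gen_conv_word flip: word_append)
qed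

lemma arrow_tail:
  assumes "\<alpha> \<in> arcs Q" "gens_list us" "gens_list vs"
  shows "W (us @ Arrow \<alpha> # Vertex (tail Q \<alpha>) # vs) \<doteq> W (us @ Arrow \<alpha> # vs)"
proof -
  have "ar \<alpha> * vx (tail Q \<alpha>) - ar \<alpha> \<in> (lpa_relations Q :: (_, 'k) free_elem set)"
    unfolding lpa_relations_def using assms(1) by blast
  from congruent_relation [OF this assms(2,3)] show ?thesis
    by (simp add: gen_conv_word flip: word_append)
qed

lemma tail_star:
  assumes "\<alpha> \<in> arcs Q" "gens_list us" "gens_list vs"
  shows "W (us @ Vertex (tail Q \<alpha>) # Star \<alpha> # vs) \<doteq> W (us @ Star \<alpha> # vs)"
proof -
  have "vx (tail Q \<alpha>) * st \<alpha> - st \<alpha> \<in> (lpa_relations Q :: (_, 'k) free_elem set)"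
    unfolding lpa_relations_def using assms(1) by blast
  from congruent_relation [OF this assms(2,3)] show ?thesis
    by (simp add: gen_conv_word flip: word_append)
qed

lemma star_head:
  assumes "\<alpha> \<in> arcs Q" "gens_list us" "gens_list vs"
  shows "W (us @ Star \<alpha> # Vertex (head Q \<alpha>) # vs) \<doteq> W (us @ Star \<alpha> # vs)"
proof -
  have "st \<alpha> * vx (head Q \<alpha>) - st \<alpha> \<in> (lpa_relations Q :: (_, 'k) free_elem set)"
    unfolding lpa_relations_def using assms(1) by blast
  from congruent_relation [OF this assms(2,3)] show ?thesis
    by (simp add: gen_conv_word flip: word_append)
qed

lemma arrow_star:
  assumes "\<alpha> \<in> arcs Q" "\<beta> \<in> arcs Q" "gens_list us" "gens_list vs"
  shows "W (us @ Arrow \<alpha> # Star \<beta> # vs) \<doteq> (if \<alpha> = \<beta> then W (us @ Vertex (head Q \<alpha>) # vs) else 0)"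
proof -
  have "ar \<alpha> * st \<beta> - (if \<alpha> = \<beta> then vx (head Q \<alpha>) else 0) \<in> (lpa_relations Q :: (_, 'k) free_elem set)"
    unfolding lpa_relations_def using assms(1,2) by blast
  from congruent_relation [OF this assms(3,4)] show ?thesis
    by (cases "\<alpha> = \<beta>") (simp_all add: gen_conv_word flip: word_append)
qed

lemma sum_star_arrow:
  assumes "regular_vertex Q i" "gens_list us" "gens_list vs"
  shows "(\<Sum>\<alpha>\<in>out_arcs Q i. W (us @ Star \<alpha> # Arrow \<alpha> # vs)) \<doteq> W (us @ Vertex i # vs)"
proof -
  have "(\<Sum>\<alpha>\<in>out_arcs Q i. st \<alpha> * ar \<alpha>) - vx i \<in> (lpa_relations Q :: (_, 'k) free_elem set)"
    unfolding lpa_relations_def using assms(1) by blast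
  from congruent_relation [OF this assms(2,3)] show ?thesis
    by (simp add: gen_conv_word sum_distrib_left sum_distrib_right flip: word_append)
qed

section \<open>Raising the level of a normal form\<close>

definition reducible :: "nat \<Rightarrow> (('v, 'a) lpa_gen, 'k) free_elem set" where
  "reducible n = {x. \<exists>y\<in>space_on (normal_words Q n). x \<doteq> y}"

lemma reducible_congruent: "x \<doteq> y \<Longrightarrow> y \<in> reducible n \<Longrightarrow> x \<in> reducible n"
  unfolding reducible_def using congruent_trans by blast

lemma subspace_reducible: "pm.subspace (reducible n)"
  unfolding pm.subspace_def
proof (intro conjI ballI allI)
  show "0 \<in> reducible n"
    unfolding reducible_def using pm.subspace_0 [OF subspace_space_on] congruent_refl by blast
next
  fix x y assume "x \<in> reducible n" "y \<in> reducible n"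
  then show "x + y \<in> reducible n"
    unfolding reducible_def using pm.subspace_add [OF subspace_space_on] congruent_add by blast
next
  fix c x assume "x \<in> reducible n"
  then show "pm_scale c x \<in> reducible n"
    unfolding reducible_def using pm.subspace_scale [OF subspace_space_on] congruent_scale by blast
qed

lemma path_word_reducible:
  assumes "awalk u p v" "awalk u' q v" "length q = n \<or> length q < n \<and> sink Q v"
  shows "basis_vec (path_word p v q) \<in> reducible n"
proof -
  have "path_word p v q \<in> normal_words Q n" using assms by (auto simp: normal_words_def)
  then have "basis_vec (path_word p v q) \<in> space_on (normal_words Q n)" by simp
  then show ?thesis unfolding reducible_def using congruent_refl by blast
qed

lemma gens_list_walk:
  assumes "awalk u p v"
  shows "gens_list (map Star p)" "gens_list (map Arrow (rev p))" "v \<in> verts Q"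
  using assms awalk_last_in_verts [OF assms] by (auto simp: awalk_def)

text \<open>If \<open>v\<close> is a sink, the word is admissible at level \<open>Suc n\<close> as
  it stands, since \<open>q\<close> has length at most \<open>n\<close>. Otherwise \<open>q\<close>
  has length exactly \<open>n\<close> and \<open>v\<close> is regular by row-finiteness, so the
  vertex in the middle can be expanded; each summand lengthens both \<open>p\<close> and
  \<open>q\<close> by the same last arrow.\<close>

lemma reducible_Suc: "reducible n \<subseteq> reducible (Suc n)"
proof -
  have "basis_vec w \<in> reducible (Suc n)" if w: "w \<in> normal_words Q n" for w
  proof -
    obtain p v q u u' where w': "w = path_word p v q" and p: "awalk u p v" and q: "awalk u' q v"
      and n: "length q = n \<or> length q < n \<and> sink Q v"
      using w by (auto simp: normal_words_def)
    note gens = gens_list_walk(1) [OF p] gens_list_walk(3) [OF p] gens_list_walk(2) [OF q]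
    show ?thesis
    proof (cases "sink Q v")
      case True
      then show ?thesis using path_word_reducible [OF p q, of "Suc n"] n w' by auto
    next
      case False
      let ?us = "map Star p" and ?vs = "map Arrow (rev q)"
      have "regular_vertex Q v"
        using False gens(2) row_finite by (auto simp: regular_vertex_def row_finite_def)
      then have "W (?us @ Vertex v # ?vs) \<doteq> (\<Sum>\<alpha>\<in>out_arcs Q v. W (?us @ Star \<alpha> # Arrow \<alpha> # ?vs))"
        using gens by (intro congruent_sym [OF sum_star_arrow])
      also have "\<dots> \<doteq> (\<Sum>\<alpha>\<in>out_arcs Q v. basis_vec (path_word (p @ [\<alpha>]) (head Q \<alpha>) (q @ [\<alpha>])))"
      proof (rule congruent_sum)
        fix \<alpha> assume "\<alpha> \<in> out_arcs Q v"
        \<comment> \<open>The expansion replaces the middle vertex by a star and an arrow; the head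
          of \<alpha> is inserted between them to obtain a path word again.\<close>
        then have "W ((?us @ [Star \<alpha>]) @ Arrow \<alpha> # ?vs) \<doteq>
            W ((?us @ [Star \<alpha>]) @ Vertex (head Q \<alpha>) # Arrow \<alpha> # ?vs)"
          using gens by (intro congruent_sym [OF head_arrow]) auto
        then show "W (?us @ Star \<alpha> # Arrow \<alpha> # ?vs) \<doteq>
            basis_vec (path_word (p @ [\<alpha>]) (head Q \<alpha>) (q @ [\<alpha>]))"
          by (simp add: word_def path_word_def)
      qed
      finally have "basis_vec w \<doteq> (\<Sum>\<alpha>\<in>out_arcs Q v. basis_vec (path_word (p @ [\<alpha>]) (head Q \<alpha>) (q @ [\<alpha>])))"
        by (simp add: w' path_word_def word_def)
      moreover have "(\<Sum>\<alpha>\<in>out_arcs Q v. basis_vec (path_word (p @ [\<alpha>]) (head Q \<alpha>) (q @ [\<alpha>]))) \<in> reducible (Suc n)"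
      proof (rule pm.subspace_sum [OF subspace_reducible])
        fix \<alpha> assume "\<alpha> \<in> out_arcs Q v"
        then have "awalk v [\<alpha>] (head Q \<alpha>)" by (auto simp: awalk_Cons_iff awalk_Nil_iff)
        then show "basis_vec (path_word (p @ [\<alpha>]) (head Q \<alpha>) (q @ [\<alpha>])) \<in> reducible (Suc n)"
          using p q n False by (intro path_word_reducible) (auto intro: awalk_appendI)
      qed
      ultimately show ?thesis by (rule reducible_congruent)
    qed
  qed
  then have "space_on (normal_words Q n) \<subseteq> reducible (Suc n)"
    by (rule space_on_subset [OF subspace_reducible])
  then show ?thesis
    using reducible_congruent [of _ _ "Suc n"] by (auto simp: reducible_def [of n])
qed

text \<open>A union of an increasing chain of subspaces: two elements of different levels can be
  added at the larger level.\<close>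

lemma subspace_Union_reducible: "pm.subspace (\<Union>n. reducible n)"
proof -
  have mono: "reducible m \<subseteq> reducible n" if "m \<le> n" for m n
    using reducible_Suc that by (rule lift_Suc_mono_le)
  show ?thesis
    unfolding pm.subspace_def
  proof (intro conjI ballI allI)
    fix x y assume "x \<in> (\<Union>n. reducible n)" "y \<in> (\<Union>n. reducible n)"
    then obtain m n where "x \<in> reducible m" "y \<in> reducible n" by blast
    then have "x \<in> reducible (max m n)" "y \<in> reducible (max m n)"
      using mono [of m "max m n"] mono [of n "max m n"] by auto
    then show "x + y \<in> (\<Union>n. reducible n)"
      using pm.subspace_add [OF subspace_reducible] by blast
  next
    fix c x assume "x \<in> (\<Union>n. reducible n)"
    then show "pm_scale c x \<in> (\<Union>n. reducible n)"
      using pm.subspace_scale [OF subspace_reducible] by blast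
  qed (use pm.subspace_0 [OF subspace_reducible] in blast)
qed

lemma path_word_Union:
  assumes "awalk u p v" "awalk u' q v"
  shows "basis_vec (path_word p v q) \<in> (\<Union>n. reducible n)"
  using path_word_reducible [OF assms, of "length q"] by blast

lemma zero_Union: "0 \<in> (\<Union>n. reducible n)"
  using pm.subspace_0 [OF subspace_reducible] by blast

lemma Union_congruent: "x \<doteq> y \<Longrightarrow> y \<in> (\<Union>n. reducible n) \<Longrightarrow> x \<in> (\<Union>n. reducible n)"
  using reducible_congruent by blast

section \<open>Multiplying a path word by a generator\<close>

lemma vertex_path_word:
  assumes p: "awalk u p v" and i: "i \<in> verts Q" and gens: "gens_list us" "gens_list vs"
  shows "W (us @ Vertex i # map Star p @ Vertex v # vs) \<doteq>
    (if i = u then W (us @ map Star p @ Vertex v # vs) else 0)"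
proof (cases p)
  case Nil
  then show ?thesis
    using vertex_vertex [of i v us vs] p i gens by (auto simp: awalk_Nil_iff)
next
  case (Cons \<beta> p')
  let ?ws = "map Star p' @ Vertex v # vs"
  have \<beta>: "\<beta> \<in> arcs Q" "tail Q \<beta> = u" using p Cons by (auto simp: awalk_Cons_iff)
  have u: "u \<in> verts Q" using p by (rule awalk_hd_in_verts)
  have ws: "gens_list ?ws" "gens_list (Star \<beta> # ?ws)" "gens_list (us @ [Vertex i])"
    using gens_list_walk(1,3) [OF p] gens Cons i by auto
  \<comment> \<open>The start \<open>u\<close> of the first star is inserted in front of it, so that
    it can be compared with \<open>i\<close> as a product of two vertices.\<close>
  have "W ((us @ [Vertex i]) @ Star \<beta> # ?ws) \<doteq> W ((us @ [Vertex i]) @ Vertex u # Star \<beta> # ?ws)"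
    using congruent_sym [OF tail_star [OF \<beta>(1) ws(3,1)]] \<beta>(2) by simp
  also have "\<dots> \<doteq> (if i = u then W (us @ Vertex u # Star \<beta> # ?ws) else 0)"
    using vertex_vertex [OF i u gens(1) ws(2)] by (cases "i = u") simp_all
  also have "\<dots> \<doteq> (if i = u then W (us @ Star \<beta> # ?ws) else 0)"
    using tail_star [OF \<beta>(1) gens(1) ws(1)] \<beta>(2) by simp
  finally show ?thesis using Cons by (cases "i = u") simp_all
qed

text \<open>Up to congruence the product is zero or a single path word. A vertex is absorbed; a star
  becomes the new first arrow of \<open>p\<close>; an arrow cancels against the first star of
  \<open>p\<close>, or becomes the new last arrow of \<open>q\<close> when \<open>p\<close> is
  trivial.\<close>

lemma gen_path_word:
  assumes x: "x \<in> lpa_gens Q" and p: "awalk u p v" and q: "awalk u' q v"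
  shows "W (x # letters (path_word p v q)) \<in> (\<Union>n. reducible n)"
proof -
  let ?vs = "map Arrow (rev q)"
  have vs: "gens_list ?vs" and v: "v \<in> verts Q"
    using gens_list_walk(1) [OF p] gens_list_walk(2,3) [OF q] by auto
  have W: "W (map Star p @ Vertex v # ?vs) \<in> (\<Union>n. reducible n)" if "awalk u p v" for u p
    using path_word_Union [OF that q] by (simp add: path_word_def word_def)
  have vertex: "W (Vertex i # map Star p @ Vertex v # ?vs) \<in> (\<Union>n. reducible n)"
    if "i \<in> verts Q" "awalk u p v" for i u p
  proof (rule Union_congruent)
    show "W (Vertex i # map Star p @ Vertex v # ?vs) \<doteq>
        (if i = u then W (map Star p @ Vertex v # ?vs) else 0)"
      using vertex_path_word [OF that(2,1), of "[]" ?vs] vs by (cases "i = u") simp_all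
    show "(if i = u then W (map Star p @ Vertex v # ?vs) else 0) \<in> (\<Union>n. reducible n)"
      using W [OF that(2)] zero_Union by simp
  qed
  show ?thesis
  proof (cases x)
    case (Vertex i)
    then show ?thesis using vertex [of i u p] x p by (simp add: path_word_def)
  next
    case (Star \<alpha>)
    then have \<alpha>: "\<alpha> \<in> arcs Q" using x by simp
    let ?ws = "map Star p @ Vertex v # ?vs"
    have ws: "gens_list ?ws" using gens_list_walk(1) [OF p] gens_list_walk(2,3) [OF q] by auto
    \<comment> \<open>Inserting the head of \<alpha> behind the star tests whether \<alpha> and
      \<open>p\<close> are composable: if not, the word is congruent to zero.\<close>
    have "W (Star \<alpha> # ?ws) \<doteq> W ([Star \<alpha>] @ Vertex (head Q \<alpha>) # ?ws)"
      using congruent_sym [OF star_head [of \<alpha> "[]" ?ws]] \<alpha> ws by simp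
    also have "\<dots> \<doteq> (if head Q \<alpha> = u then W (Star \<alpha> # ?ws) else 0)"
      using vertex_path_word [OF p, of "head Q \<alpha>" "[Star \<alpha>]" ?vs] \<alpha> vs awalk_hd_in_verts [OF p]
      by (cases "head Q \<alpha> = u") simp_all
    finally have *: "W (Star \<alpha> # ?ws) \<doteq> (if head Q \<alpha> = u then W (Star \<alpha> # ?ws) else 0)" .
    have "W (Star \<alpha> # ?ws) \<in> (\<Union>n. reducible n)" if "head Q \<alpha> = u"
      using W [of "tail Q \<alpha>" "\<alpha> # p"] that \<alpha> p by (simp add: awalk_Cons_iff)
    then have "(if head Q \<alpha> = u then W (Star \<alpha> # ?ws) else 0) \<in> (\<Union>n. reducible n)"
      using zero_Union by simp
    with * have "W (Star \<alpha> # ?ws) \<in> (\<Union>n. reducible n)" by (rule Union_congruent)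
    then show ?thesis using Star by (simp add: path_word_def)
  next
    case (Arrow \<alpha>)
    then have \<alpha>: "\<alpha> \<in> arcs Q" using x by simp
    show ?thesis
    proof (cases p)
      case Nil
      \<comment> \<open>With \<open>p\<close> trivial, the tail of \<alpha> meets the vertex
        \<open>v\<close> at the end of \<open>q\<close>. Only if they agree does \<alpha> prolong
        \<open>q\<close>; its head then becomes the new middle vertex.\<close>
      have "W ([] @ Arrow \<alpha> # Vertex v # ?vs) \<doteq> W ([] @ Arrow \<alpha> # Vertex (tail Q \<alpha>) # Vertex v # ?vs)"
        using \<alpha> vs v by (intro congruent_sym [OF arrow_tail]) auto
      also have "\<dots> = W ([Arrow \<alpha>] @ Vertex (tail Q \<alpha>) # Vertex v # ?vs)" by simp
      also have "\<dots> \<doteq> (if tail Q \<alpha> = v then W ([Arrow \<alpha>] @ Vertex (tail Q \<alpha>) # ?vs) else 0)"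
        using \<alpha> vs v by (intro vertex_vertex) auto
      also have "\<dots> \<doteq> (if tail Q \<alpha> = v then W ([] @ Arrow \<alpha> # ?vs) else 0)"
        using arrow_tail [of \<alpha> "[]" ?vs] \<alpha> vs by (cases "tail Q \<alpha> = v") simp_all
      also have "\<dots> \<doteq> (if tail Q \<alpha> = v then W ([] @ Vertex (head Q \<alpha>) # Arrow \<alpha> # ?vs) else 0)"
        using congruent_sym [OF head_arrow [of \<alpha> "[]" ?vs]] \<alpha> vs by (cases "tail Q \<alpha> = v") simp_all
      finally have *: "W (x # letters (path_word p v q)) \<doteq>
          (if tail Q \<alpha> = v then basis_vec (path_word [] (head Q \<alpha>) (q @ [\<alpha>])) else 0)"
        using Nil Arrow by (cases "tail Q \<alpha> = v") (simp_all add: path_word_def word_def)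
      have "basis_vec (path_word [] (head Q \<alpha>) (q @ [\<alpha>])) \<in> (\<Union>n. reducible n)" if "tail Q \<alpha> = v"
      proof (rule path_word_Union)
        show "awalk (head Q \<alpha>) [] (head Q \<alpha>)" using \<alpha> by (simp add: awalk_Nil_iff)
        show "awalk u' (q @ [\<alpha>]) (head Q \<alpha>)"
          using q that \<alpha> by (auto intro!: awalk_appendI simp: awalk_Cons_iff awalk_Nil_iff)
      qed
      then have "(if tail Q \<alpha> = v then basis_vec (path_word [] (head Q \<alpha>) (q @ [\<alpha>])) else 0)
          \<in> (\<Union>n. reducible n)"
        using zero_Union by simp
      with * show ?thesis by (rule Union_congruent)
    next
      case (Cons \<beta> p')
      let ?ws = "map Star p' @ Vertex v # ?vs"
      have \<beta>: "\<beta> \<in> arcs Q" "awalk (head Q \<beta>) p' v" using p Cons by (auto simp: awalk_Cons_iff)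
      have ws: "gens_list ?ws" using gens_list_walk(1) [OF p] gens_list_walk(2,3) [OF q] Cons by auto
      have "W (Arrow \<alpha> # Star \<beta> # ?ws) \<doteq> (if \<alpha> = \<beta> then W (Vertex (head Q \<alpha>) # ?ws) else 0)"
        using arrow_star [of \<alpha> \<beta> "[]" ?ws] \<alpha> \<beta> ws by (cases "\<alpha> = \<beta>") simp_all
      moreover have "(if \<alpha> = \<beta> then W (Vertex (head Q \<alpha>) # ?ws) else 0) \<in> (\<Union>n. reducible n)"
        using vertex [of "head Q \<beta>" "head Q \<beta>" p'] \<beta> zero_Union by simp
      ultimately have "W (Arrow \<alpha> # Star \<beta> # ?ws) \<in> (\<Union>n. reducible n)" by (rule Union_congruent)
      then show ?thesis using Cons Arrow by (simp add: path_word_def)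
    qed
  qed
qed

text \<open>Words are built from the right: the tail has a normal form, and multiplying it by one
  more generator remains in the span. A single letter becomes a path word by inserting the head of
  its arrow, or is already a vertex.\<close>

lemma word_Union:
  assumes "xs \<noteq> []" "gens_list xs"
  shows "W xs \<in> (\<Union>n. reducible n)"
  using assms
proof (induction xs)
  case (Cons x xs)
  show ?case
  proof (cases "xs = []")
    case False
    then obtain n y where y: "y \<in> space_on (normal_words Q n)" "W xs \<doteq> y"
      using Cons by (auto simp: reducible_def)
    have "W [x] * W xs * W [] \<doteq> W [x] * y * W []"
      using y(2) Cons.prems by (intro congruent_word_mult) auto
    then have *: "W (x # xs) \<doteq> W [x] * y"
      using word_append [of "[x]" xs, where 'b = 'k] by simp
    have "Vector_Spaces.linear pm_scale pm_scale ((*) (W [x]))"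
      by (simp add: Vector_Spaces.linear_iff pm.vector_space_axioms distrib_left pm_scale_mult_right)
    then have "W [x] * y \<in> (\<Union>n. reducible n)"
    proof (rule linear_maps_space_on [OF _ subspace_Union_reducible _ y(1)])
      fix w assume "w \<in> normal_words Q n"
      then obtain p v q u u' where "w = path_word p v q" "awalk u p v" "awalk u' q v"
        by (auto simp: normal_words_def)
      then have "W (x # letters w) \<in> (\<Union>n. reducible n)"
        using gen_path_word [of x u p v u' q] Cons.prems(2) by simp
      moreover have "W (x # letters w) = W [x] * basis_vec w"
        using word_append [of "[x]" "letters w", where 'b = 'k] by (simp add: word_def)
      ultimately show "W [x] * basis_vec w \<in> (\<Union>n. reducible n)" by (simp only:)
    qed
    with * show ?thesis by (rule Union_congruent)
  next
    case True
    have x: "x \<in> lpa_gens Q" using Cons.prems by simp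
    show ?thesis
    proof (cases x)
      case (Vertex i)
      then show ?thesis using path_word_Union [of i "[]" i i "[]"] x True
        by (simp add: path_word_def word_def awalk_Nil_iff)
    next
      case (Star \<alpha>)
      then have "awalk (tail Q \<alpha>) [\<alpha>] (head Q \<alpha>)" "awalk (head Q \<alpha>) [] (head Q \<alpha>)"
        using x by (auto simp: awalk_Cons_iff awalk_Nil_iff)
      then have "basis_vec (path_word [\<alpha>] (head Q \<alpha>) []) \<in> (\<Union>n. reducible n)"
        by (rule path_word_Union)
      moreover have "W [x] \<doteq> basis_vec (path_word [\<alpha>] (head Q \<alpha>) [])"
        using congruent_sym [OF star_head [of \<alpha> "[]" "[]"]] Star x by (simp add: path_word_def word_def)
      ultimately show ?thesis using True Union_congruent by simp
    next
      case (Arrow \<alpha>)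
      then have "awalk (head Q \<alpha>) [] (head Q \<alpha>)" "awalk (tail Q \<alpha>) [\<alpha>] (head Q \<alpha>)"
        using x by (auto simp: awalk_Cons_iff awalk_Nil_iff)
      then have "basis_vec (path_word [] (head Q \<alpha>) [\<alpha>]) \<in> (\<Union>n. reducible n)"
        by (rule path_word_Union)
      moreover have "W [x] \<doteq> basis_vec (path_word [] (head Q \<alpha>) [\<alpha>])"
        using congruent_sym [OF head_arrow [of \<alpha> "[]" "[]"]] Arrow x by (simp add: path_word_def word_def)
      ultimately show ?thesis using True Union_congruent by simp
    qed
  qed
qed simp

lemma normal_form:
  fixes x :: "(('v, 'a) lpa_gen, 'k) free_elem"
  assumes "x \<in> free_algebra (lpa_gens Q)"
  obtains n y where "y \<in> space_on (normal_words Q n)"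
    "x - y \<in> relation_ideal (lpa_gens Q) (lpa_relations Q)"
proof -
  have "basis_vec w \<in> (\<Union>n. reducible n)"
    if "w \<in> {w. letters w \<noteq> [] \<and> set (letters w) \<subseteq> lpa_gens Q}" for w
    using word_Union [of "letters w"] that by (simp add: word_def)
  from space_on_subset [OF subspace_Union_reducible this] assms
  have "x \<in> (\<Union>n. reducible n)" unfolding free_algebra_def by blast
  then show ?thesis using that by (auto simp: reducible_def congruent_def)
qed

end

section \<open>Faithfulness\<close>

text \<open>An infinite path \<open>p\<close> always has a first arrow \<open>p 0\<close>, so the
  alternative of starting at a sink never has to be used.\<close>

lemma path_module_F:
  assumes "wf_digraph Q"
  shows "path_module Q (left_infinite_paths Q) (start_inf Q) case_nat
    (F_basis_action Q :: ('v, 'a) lpa_gen \<Rightarrow> (nat \<Rightarrow> 'a) \<Rightarrow> ((nat \<Rightarrow> 'a) \<Rightarrow>\<^sub>0 'k::field))"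
proof -
  interpret wf_digraph Q by fact
  have truncate_cons: "truncate_inf 1 (case_nat \<alpha> p) = p" for \<alpha> :: 'a and p
    by (simp add: truncate_inf_def)
  show ?thesis
  proof
    fix \<alpha> p assume p: "p \<in> left_infinite_paths Q" and \<alpha>: "\<alpha> \<in> arcs Q" "head Q \<alpha> = start_inf Q p"
    then show "case_nat \<alpha> p \<in> left_infinite_paths Q"
      by (auto simp: left_infinite_paths_def start_inf_def split: nat.split)
    show "start_inf Q (case_nat \<alpha> p) = tail Q \<alpha>" by (simp add: start_inf_def)
    show "F_basis_action Q (Arrow \<beta>) (case_nat \<alpha> p) = (if \<beta> = \<alpha> then basis_vec p else 0)" for \<beta>
      using truncate_cons [of \<alpha> p] by simp
  next
    fix p assume p: "p \<in> left_infinite_paths Q"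
    have "p = case_nat (p 0) (truncate_inf 1 p)"
      by (auto simp: truncate_inf_def split: nat.split)
    moreover have "p 0 \<in> arcs Q" "truncate_inf 1 p \<in> left_infinite_paths Q"
      "head Q (p 0) = start_inf Q (truncate_inf 1 p)"
      using p by (auto simp: left_infinite_paths_def truncate_inf_def start_inf_def)
    ultimately show "sink Q (start_inf Q p) \<and> (\<forall>\<alpha>. F_basis_action Q (Arrow \<alpha>) p = 0) \<or>
        (\<exists>\<alpha>\<in>arcs Q. \<exists>c\<in>left_infinite_paths Q. head Q \<alpha> = start_inf Q c \<and> p = case_nat \<alpha> c)"
      by blast
  qed simp_all
qed

lemma path_module_N:
  assumes "wf_digraph Q"
  shows "path_module Q (sink_paths Q) fst (\<lambda>\<alpha> (u, w). (tail Q \<alpha>, \<alpha> # w))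
    (N_basis_action Q :: ('v, 'a) lpa_gen \<Rightarrow> 'v \<times> 'a list \<Rightarrow> ('v \<times> 'a list \<Rightarrow>\<^sub>0 'k::field))"
proof -
  interpret wf_digraph Q by fact
  show ?thesis
  proof
    fix b :: "'v \<times> 'a list" assume b: "b \<in> sink_paths Q"
    then obtain u w v where b': "b = (u, w)" and w: "awalk u w v" "sink Q v"
      by (auto simp: sink_paths_def)
    show "sink Q (fst b) \<and> (\<forall>\<alpha>. N_basis_action Q (Arrow \<alpha>) b = 0) \<or>
        (\<exists>\<alpha>\<in>arcs Q. \<exists>c\<in>sink_paths Q. head Q \<alpha> = fst c \<and> b = (\<lambda>(u, w). (tail Q \<alpha>, \<alpha> # w)) c)"
    proof (cases w)
      case Nil
      then show ?thesis using w b' by (simp add: awalk_Nil_iff)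
    next
      case (Cons \<alpha> w')
      then have "\<alpha> \<in> arcs Q" "(head Q \<alpha>, w') \<in> sink_paths Q" "b = (tail Q \<alpha>, \<alpha> # w')"
        using w b' by (auto simp: sink_paths_def awalk_Cons_iff)
      then show ?thesis by force
    qed
  qed (auto simp: sink_paths_def awalk_Cons_iff)
qed

lemma foldr_case_nat:
  "foldr case_nat r p n = (if n < length r then r ! n else p (n - length r))"
  by (induction r arbitrary: n) (auto simp: nth_Cons' split: nat.split)

text \<open>If prefixing \<open>r\<close> does not change \<open>p\<close>, then \<open>p\<close>
  begins with \<open>r\<close> and has period \<open>length r\<close>; strong induction on the
  position gives \<open>p n = r ! (n mod length r)\<close>.\<close>

lemma periodic_imp_cyclic_inf:
  assumes r: "pre_digraph.awalk Q v r v" "r \<noteq> []" and p: "foldr case_nat r p = p"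
  shows "cyclic_inf Q p"
proof -
  have "p n = r ! (n mod length r)" for n
  proof (induction n rule: less_induct)
    case (less n)
    have "p n = (if n < length r then r ! n else p (n - length r))"
      by (subst p [symmetric]) (rule foldr_case_nat)
    moreover have "n - length r < n" if "\<not> n < length r"
      using that r(2) by (cases r) auto
    ultimately show ?case
      using less [of "n - length r"] by (auto simp: le_mod_geq)
  qed
  then have "p = cycle_power r" by (simp add: cycle_power_def fun_eq_iff)
  with r show ?thesis by (auto simp: cyclic_inf_def oriented_cycle_def)
qed

theorem proposition4p4:
  fixes Q :: "('v, 'a) pre_digraph"
  assumes "wf_digraph Q"
    and "row_finite Q"
    and "\<And>i. i \<in> verts Q \<Longrightarrow>
      (\<exists>w. (i, w) \<in> sink_paths Q) \<or>
      (\<exists>p \<in> left_infinite_paths Q. start_inf Q p = i \<and> \<not> cyclic_inf Q p)"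
  shows "faithful_representation
    (leavitt_path_algebra Q :: ('k::field, (('v, 'a) lpa_gen, 'k) free_elem set) nonunital_algebra)
    (rep_sum (F_rep Q) (N_rep Q))"
proof -
  interpret wf_digraph Q by fact
  interpret F: path_module Q "left_infinite_paths Q" "start_inf Q" case_nat
    "F_basis_action Q :: ('v, 'a) lpa_gen \<Rightarrow> (nat \<Rightarrow> 'a) \<Rightarrow> ((nat \<Rightarrow> 'a) \<Rightarrow>\<^sub>0 'k)"
    by (rule path_module_F) fact
  interpret N: path_module Q "sink_paths Q" fst "\<lambda>\<alpha> (u, w). (tail Q \<alpha>, \<alpha> # w)"
    "N_basis_action Q :: ('v, 'a) lpa_gen \<Rightarrow> 'v \<times> 'a list \<Rightarrow> ('v \<times> 'a list \<Rightarrow>\<^sub>0 'k)"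
    by (rule path_module_N) fact
  interpret L: leavitt Q "TYPE('k)"
    by (intro leavitt.intro leavitt_axioms.intro) (rule assms F.presentation_axioms)+
  let ?A = "leavitt_path_algebra Q :: ('k, (('v, 'a) lpa_gen, 'k) free_elem set) nonunital_algebra"
    and ?F = "F_rep Q :: ('k, (('v, 'a) lpa_gen, 'k) free_elem set, _) rep"
    and ?N = "N_rep Q :: ('k, (('v, 'a) lpa_gen, 'k) free_elem set, _) rep"
    and ?cls = "relation_class (lpa_gens Q) (lpa_relations Q :: (('v, 'a) lpa_gen, 'k) free_elem set)"
  have "representation ?A ?F" "representation ?A ?N"
    unfolding leavitt_path_algebra_def F_rep_def N_rep_def
    by (rule F.representation_presented_rep N.representation_presented_rep)+
  then have rep: "representation ?A (rep_sum ?F ?N)" by (rule representation_rep_sum)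
  have F_map: "rep_map ?F (?cls a) = (\<lambda>m\<in>space_on (left_infinite_paths Q). F.action a m)"
    and N_map: "rep_map ?N (?cls a) = (\<lambda>m\<in>space_on (sink_paths Q). N.action a m)"
    if "a \<in> free_algebra (lpa_gens Q)" for a
    using F.rep_map_class [OF that] N.rep_map_class [OF that] unfolding F_rep_def N_rep_def by auto
  have spaces: "rep_space ?F = space_on (left_infinite_paths Q)" "rep_space ?N = space_on (sink_paths Q)"
    by (simp_all add: F_rep_def N_rep_def presented_rep_def)
  have "inj_on (rep_map (rep_sum ?F ?N)) (alg_carrier ?A)"
  proof (rule inj_onI)
    fix S T assume S: "S \<in> alg_carrier ?A" and T: "T \<in> alg_carrier ?A"
      and eq: "rep_map (rep_sum ?F ?N) S = rep_map (rep_sum ?F ?N) T"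
    obtain a b where a: "S = ?cls a" "a \<in> free_algebra (lpa_gens Q)"
      and b: "T = ?cls b" "b \<in> free_algebra (lpa_gens Q)"
      using S T by (auto simp: leavitt_path_algebra_def presented_algebra_def)
    have eval: "(rep_map ?F S m, rep_map ?N S m') = (rep_map ?F T m, rep_map ?N T m')"
      if "m \<in> rep_space ?F" "m' \<in> rep_space ?N" for m m'
      using fun_cong [OF eq, of "(m, m')"] that by (simp add: rep_sum_def)
    \<comment> \<open>Evaluating at pairs with one zero component separates the two
      summands.\<close>
    have F_eq: "F.action (a - b) m = 0" if "m \<in> space_on (left_infinite_paths Q)" for m
      using eval [of m 0] that a b by (simp add: spaces F_map)
    have N_eq: "N.action (a - b) m = 0" if "m \<in> space_on (sink_paths Q)" for m
      using eval [of 0 m] that a b by (simp add: spaces N_map)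
    have "a - b \<in> free_algebra (lpa_gens Q)"
      using a b by (intro pm.subspace_diff [OF subspace_free_algebra])
    then obtain n y where y: "y \<in> space_on (normal_words Q n)" and ideal: "(a - b) - y \<in> relation_ideal (lpa_gens Q) (lpa_relations Q)"
      by (rule L.normal_form)
    \<comment> \<open>The normal form \<open>y\<close> differs from \<open>a - b\<close> by an
      element of the ideal, so it annihilates the same modules.\<close>
    have F_y: "F.action y m = 0" if "m \<in> space_on (left_infinite_paths Q)" for m
      using F.relation_ideal_act [OF ideal that] F_eq [OF that] by simp
    have N_y: "N.action y m = 0" if "m \<in> space_on (sink_paths Q)" for m
      using N.relation_ideal_act [OF ideal that] N_eq [OF that] by simp
    have "Poly_Mapping.lookup y w = 0" if w_in: "w \<in> normal_words Q n" for w
    proof -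
      obtain p v q u u' where w: "w = path_word p v q" and p: "awalk u p v" and q: "awalk u' q v"
        and n: "length q = n \<or> length q < n \<and> sink Q v"
        using w_in by (auto simp: normal_words_def)
      have "v \<in> verts Q" using p by (rule awalk_last_in_verts)
      \<comment> \<open>The hypothesis is used at the middle vertex \<open>v\<close>; the path it
        provides is the test path \<open>b\<close> for the coefficient of \<open>w\<close>, in one
        summand or the other.\<close>
      from assms(3) [OF this] show ?thesis
      proof (elim disjE exE bexE conjE)
        fix s assume s: "(v, s) \<in> sink_paths Q"
        have snd_foldr: "snd (foldr (\<lambda>\<alpha> (u, w). (tail Q \<alpha>, \<alpha> # w)) r (v, s)) = r @ s" for r
          by (induction r) (auto split: prod.splits)
        \<comment> \<open>Prefixing \<open>r\<close> to a finite path makes it longer unless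
          \<open>r\<close> is trivial.\<close>
        have "r = []" if "foldr (\<lambda>\<alpha> (u, w). (tail Q \<alpha>, \<alpha> # w)) r (v, s) = (v, s)" for r
          using snd_foldr [of r] that by simp
        then show ?thesis
          using N.coefficient_zero [OF y N_y _ _ _ s, of u p u' q] p q n by (simp add: w)
      next
        fix x assume x: "x \<in> left_infinite_paths Q" and v: "start_inf Q x = v" and "\<not> cyclic_inf Q x"
        \<comment> \<open>A nontrivial \<open>r\<close> would make \<open>x\<close> cyclic.\<close>
        then have "r = []" if "awalk v r v" "foldr case_nat r x = x" for r
          using periodic_imp_cyclic_inf [OF that(1) _ that(2)] by blast
        then show ?thesis
          using F.coefficient_zero [OF y F_y _ _ _ x, of u p u' q] p q n v by (simp add: w)
      qed
    qed
    then have "y = 0"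
      using y by (intro poly_mapping_eqI) (auto simp: space_on_def in_keys_iff subset_iff)
    \<comment> \<open>With \<open>y = 0\<close> the difference \<open>a - b\<close> itself lies in
      the ideal.\<close>
    then have "?cls a = ?cls b"
      using ideal a(2) b(2) by (simp add: F.relation_class_eq_iff)
    then show "S = T" using a b by simp
  qed
  with rep show ?thesis by (simp add: faithful_representation_def)
qed

end
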